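(* Let $p$ be a prime and let $\mathcal{F}=\{F_1,\dots,F_n\}$ with $F_i(x)=(-1)^{b_i}p^{k_i}x+d_i$, where $b_i\in\{0,1\}$, $k_i\in\mathbb{Z}$, $k_i\ge1$ and $d_i\in\mathbb{Z}_p\cap\mathbb{Q}$, and let $K$ be its $p$-adic self-similar set. Then there exists a deterministic finite automaton, with a unique essential class, recognizing the language of $p$-adic expansions of the elements of $K$.
   Context: $K$ is the unique non-empty compact subset of $\mathbb{Q}_p$ with $K=\bigcup_iF_i(K)$. A deterministic finite automaton over $\{0,\dots,p-1\}$ has at most one transition per state and digit; all states are accepting, and it recognizes a set of infinite words if these are exactly the label sequences of infinite paths from its initial state. The language of $p$-adic expansions of $K$ is the set of digit sequences $c_0c_1\dots$ ($c_i\in\{0,\dots,p-1\}$) with $\sum c_ip^i\in K$. In the state graph, a loop class is a set of states any two of which are joined by a path inside it; an essential class is a maximal loop class such that every path starting in it stays in it. *)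

theory Defs
  imports "HOL-Analysis.Analysis" "Berlekamp_Zassenhaus.Finite_Field"
begin

section \<open>The \<open>p\<close>-adic absolute value on the rationals\<close>

definition rat_padic_abs :: "nat \<Rightarrow> rat \<Rightarrow> real" where
  "rat_padic_abs p x =
     (if x = 0 then 0
      else real p powi (int (multiplicity (int p) (snd (quotient_of x)))
                          - int (multiplicity (int p) (fst (quotient_of x)))))"

lemma rat_padic_abs_zero [simp]: "rat_padic_abs p 0 = 0"
  by (simp add: rat_padic_abs_def)

lemma rat_padic_abs_nonneg [simp]: "0 \<le> rat_padic_abs p x"
  by (simp add: rat_padic_abs_def)

text \<open>\<open>p\<close>-adic Cauchy sequences and null sequences of rationals.\<close>

definition padic_cauchy :: "nat \<Rightarrow> (nat \<Rightarrow> rat) \<Rightarrow> bool" where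
  "padic_cauchy p X \<longleftrightarrow> (\<forall>e>0. \<exists>N. \<forall>m\<ge>N. \<forall>n\<ge>N. rat_padic_abs p (X m - X n) < e)"

definition padic_null :: "nat \<Rightarrow> (nat \<Rightarrow> rat) \<Rightarrow> bool" where
  "padic_null p X \<longleftrightarrow> (\<lambda>n. rat_padic_abs p (X n)) \<longlonglongrightarrow> 0"

context
  fixes p :: nat
  assumes p: "prime p"
begin

private abbreviation (input) A :: "rat \<Rightarrow> real" where "A \<equiv> rat_padic_abs p"
private abbreviation (input) mu :: "int \<Rightarrow> int" where "mu a \<equiv> int (multiplicity (int p) a)"

private lemma p_gt_1: "real p > 1"
  using prime_gt_1_nat[OF p] by simp

private lemma mu_mult: "a \<noteq> 0 \<Longrightarrow> b \<noteq> 0 \<Longrightarrow> mu (a * b) = mu a + mu b"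
  using p by (simp add: prime_elem_multiplicity_mult_distrib)

lemma rat_padic_abs_divide:
  assumes "a \<noteq> 0" "b \<noteq> 0"
  shows "rat_padic_abs p (of_int a / of_int b)
           = real p powi (int (multiplicity (int p) b) - int (multiplicity (int p) a))"
proof -
  define x :: rat where "x = of_int a / of_int b"
  obtain c d where cd: "quotient_of x = (c, d)" by fastforce
  have d: "d > 0" using quotient_of_denom_pos[OF cd] .
  have x: "x = of_int c / of_int d" using quotient_of_div[OF cd] .
  have x0: "x \<noteq> 0" using assms by (simp add: x_def)
  then have c0: "c \<noteq> 0" using x by auto
  have "rat_of_int (a * d) = of_int (c * b)"
    using x x_def assms d by (simp add: field_simps)
  then have eq: "a * d = c * b" by (simp only: of_int_eq_iff)
  have "mu a + mu d = mu c + mu b"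
    using mu_mult[of a d] mu_mult[of c b] assms d c0 eq by simp
  then have "mu d - mu c = mu b - mu a" by simp
  then show ?thesis
    unfolding x_def[symmetric] rat_padic_abs_def using x0 cd by simp
qed

private lemma rat_cases:
  obtains a b where "(x :: rat) = of_int a / of_int b" "b \<noteq> 0"
proof -
  obtain c d where cd: "quotient_of x = (c, d)" by fastforce
  show ?thesis
    using that quotient_of_div[OF cd] quotient_of_denom_pos[OF cd] by (metis less_irrefl)
qed

lemma rat_padic_abs_eq_0_iff [simp]: "rat_padic_abs p x = 0 \<longleftrightarrow> x = 0"
  using p_gt_1 by (simp add: rat_padic_abs_def)

lemma rat_padic_abs_mult: "rat_padic_abs p (x * y) = rat_padic_abs p x * rat_padic_abs p y"
proof (cases "x = 0 \<or> y = 0")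
  case False
  obtain a b where x: "x = of_int a / of_int b" and b: "b \<noteq> 0" by (rule rat_cases)
  obtain c d where y: "y = of_int c / of_int d" and d: "d \<noteq> 0" by (rule rat_cases)
  have a: "a \<noteq> 0" and c: "c \<noteq> 0" using False x y by auto
  have "x * y = of_int (a * c) / of_int (b * d)" by (simp add: x y)
  then have "A (x * y) = real p powi (mu (b * d) - mu (a * c))"
    using rat_padic_abs_divide[of "a * c" "b * d"] a b c d by simp
  also have "\<dots> = real p powi ((mu b - mu a) + (mu d - mu c))"
    using mu_mult a b c d by (simp add: algebra_simps)
  also have "\<dots> = A x * A y"
    unfolding x y using rat_padic_abs_divide a b c d p_gt_1 by (simp add: power_int_add)
  finally show ?thesis .
qed auto

lemma rat_padic_abs_one [simp]: "rat_padic_abs p 1 = 1"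
  using rat_padic_abs_divide[of 1 1] by simp

lemma rat_padic_abs_minus [simp]: "rat_padic_abs p (- x) = rat_padic_abs p x"
proof -
  have "rat_padic_abs p (-1) = 1" using rat_padic_abs_divide[of "-1" 1]
    by (simp add: multiplicity_unit_right)
  then show ?thesis using rat_padic_abs_mult[of "-1" x] by simp
qed

lemma rat_padic_abs_inverse: "rat_padic_abs p (inverse x) = inverse (rat_padic_abs p x)"
proof (cases "x = 0")
  case False
  then have "A x * A (inverse x) = 1"
    using rat_padic_abs_mult[of x "inverse x"] by simp
  then show ?thesis by (metis inverse_unique)
qed auto

lemma rat_padic_abs_ultrametric:
  "rat_padic_abs p (x + y) \<le> max (rat_padic_abs p x) (rat_padic_abs p y)"
proof (cases "x = 0 \<or> y = 0 \<or> x + y = 0")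
  case False
  obtain a b where x: "x = of_int a / of_int b" and b: "b \<noteq> 0" by (rule rat_cases)
  obtain c d where y: "y = of_int c / of_int d" and d: "d \<noteq> 0" by (rule rat_cases)
  have a: "a \<noteq> 0" and c: "c \<noteq> 0" using False x y by auto
  let ?u = "a * d" and ?v = "c * b" and ?w = "b * d"
  have xu: "x = of_int ?u / of_int ?w" using d by (simp add: x)
  have yv: "y = of_int ?v / of_int ?w" using b by (simp add: y)
  have s: "x + y = of_int (?u + ?v) / of_int ?w"
    unfolding xu yv by (simp add: add_divide_distrib)
  have uv0: "?u + ?v \<noteq> 0" using False s by (metis div_0 of_int_0)
  have dvd: "int p ^ min (multiplicity (int p) ?u) (multiplicity (int p) ?v) dvd ?u + ?v"
    by (intro dvd_add multiplicity_dvd') auto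
  have "\<not> is_unit (int p)" using p by (metis prime_nat_int_transfer not_prime_unit)
  then have le: "min (mu ?u) (mu ?v) \<le> mu (?u + ?v)"
    using multiplicity_geI[OF uv0 _ dvd] by linarith
  have "A (x + y) = real p powi (mu ?w - mu (?u + ?v))"
    unfolding s by (rule rat_padic_abs_divide[OF uv0]) (use b d in simp)
  also have "\<dots> \<le> real p powi (max (mu ?w - mu ?u) (mu ?w - mu ?v))"
    using le p_gt_1 by (intro power_int_increasing) auto
  also have "\<dots> \<le> max (A x) (A y)"
  proof -
    have "A x = real p powi (mu ?w - mu ?u)" "A y = real p powi (mu ?w - mu ?v)"
      unfolding xu yv using a b c d by (subst rat_padic_abs_divide; simp)+
    then show ?thesis by (auto simp: max_def)
  qed
  finally show ?thesis .
qed (auto simp: le_max_iff_disj)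

lemma rat_padic_abs_triangle: "rat_padic_abs p (x + y) \<le> rat_padic_abs p x + rat_padic_abs p y"
  using rat_padic_abs_ultrametric[of x y] rat_padic_abs_nonneg[of p x] rat_padic_abs_nonneg[of p y]
  by linarith

lemma rat_padic_abs_diff_commute: "rat_padic_abs p (x - y) = rat_padic_abs p (y - x)"
  using rat_padic_abs_minus[of "x - y"] by simp

lemma rat_padic_abs_triangle_reverse:
  "\<bar>rat_padic_abs p x - rat_padic_abs p y\<bar> \<le> rat_padic_abs p (x - y)"
  using rat_padic_abs_triangle[of y "x - y"] rat_padic_abs_triangle[of x "y - x"]
    rat_padic_abs_diff_commute[of x y] by simp


lemma padic_null_const: "padic_null p (\<lambda>_. c) \<longleftrightarrow> c = 0"
  by (simp add: padic_null_def LIMSEQ_const_iff)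

lemma padic_null_minus: "padic_null p X \<Longrightarrow> padic_null p (\<lambda>n. - X n)"
  by (simp add: padic_null_def)

lemma padic_null_add:
  assumes "padic_null p X" "padic_null p Y"
  shows "padic_null p (\<lambda>n. X n + Y n)"
  unfolding padic_null_def
proof (rule tendsto_sandwich[OF _ _ tendsto_const])
  show "(\<lambda>n. A (X n) + A (Y n)) \<longlonglongrightarrow> 0"
    using tendsto_add[OF assms[unfolded padic_null_def]] by simp
qed (use rat_padic_abs_triangle in auto)

lemma padic_null_mult_bounded:
  assumes "padic_null p X" and B: "\<forall>\<^sub>F n in sequentially. A (Y n) \<le> B"
  shows "padic_null p (\<lambda>n. X n * Y n)"
  unfolding padic_null_def
proof (rule tendsto_sandwich[OF _ _ tendsto_const])
  show "(\<lambda>n. A (X n) * B) \<longlonglongrightarrow> 0"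
    using tendsto_mult_right[OF assms(1)[unfolded padic_null_def], of B] by simp
  show "\<forall>\<^sub>F n in sequentially. A (X n * Y n) \<le> A (X n) * B"
    using B by eventually_elim (auto simp: rat_padic_abs_mult intro: mult_left_mono)
qed auto

lemma padic_cauchy_const: "padic_cauchy p (\<lambda>_. c)"
  by (auto simp: padic_cauchy_def)

lemma padic_cauchy_minus: "padic_cauchy p X \<Longrightarrow> padic_cauchy p (\<lambda>n. - X n)"
  by (simp add: padic_cauchy_def rat_padic_abs_diff_commute)

lemma padic_cauchy_add:
  assumes "padic_cauchy p X" "padic_cauchy p Y"
  shows "padic_cauchy p (\<lambda>n. X n + Y n)"
  unfolding padic_cauchy_def
proof (intro allI impI)
  fix e :: real assume e: "e > 0"
  obtain M where M: "\<And>m n. m \<ge> M \<Longrightarrow> n \<ge> M \<Longrightarrow> A (X m - X n) < e"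
    using assms(1) e unfolding padic_cauchy_def by blast
  obtain N where N: "\<And>m n. m \<ge> N \<Longrightarrow> n \<ge> N \<Longrightarrow> A (Y m - Y n) < e"
    using assms(2) e unfolding padic_cauchy_def by blast
  have "A ((X m + Y m) - (X n + Y n)) < e" if "m \<ge> max M N" "n \<ge> max M N" for m n
    using rat_padic_abs_ultrametric[of "X m - X n" "Y m - Y n"] M[of m n] N[of m n] that
    by (simp add: add_diff_add)
  then show "\<exists>N. \<forall>m\<ge>N. \<forall>n\<ge>N. A ((X m + Y m) - (X n + Y n)) < e" by blast
qed

lemma padic_cauchy_bounded:
  assumes "padic_cauchy p X"
  obtains B where "B > 0" "\<forall>\<^sub>F n in sequentially. A (X n) \<le> B"
proof -
  obtain N where N: "\<And>m n. m \<ge> N \<Longrightarrow> n \<ge> N \<Longrightarrow> A (X m - X n) < 1"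
    using assms unfolding padic_cauchy_def by (meson zero_less_one)
  have "A (X n) \<le> A (X N) + 1" if "n \<ge> N" for n
    using rat_padic_abs_triangle[of "X n - X N" "X N"] N[of n N] that by simp
  moreover have "A (X N) + 1 > 0" using rat_padic_abs_nonneg[of p "X N"] by linarith
  ultimately show ?thesis using that eventually_at_top_linorder by blast
qed

lemma padic_cauchy_mult:
  assumes X: "padic_cauchy p X" and Y: "padic_cauchy p Y"
  shows "padic_cauchy p (\<lambda>n. X n * Y n)"
  unfolding padic_cauchy_def
proof (intro allI impI)
  fix e :: real assume e: "e > 0"
  obtain B where B: "B > 0" "\<forall>\<^sub>F n in sequentially. A (X n) \<le> B"
    by (rule padic_cauchy_bounded[OF X])
  obtain C where C: "C > 0" "\<forall>\<^sub>F n in sequentially. A (Y n) \<le> C"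
    by (rule padic_cauchy_bounded[OF Y])
  obtain M where M: "\<And>m n. m \<ge> M \<Longrightarrow> n \<ge> M \<Longrightarrow> A (X m - X n) < e / C"
    using X e C(1) unfolding padic_cauchy_def by (meson divide_pos_pos)
  obtain N where N: "\<And>m n. m \<ge> N \<Longrightarrow> n \<ge> N \<Longrightarrow> A (Y m - Y n) < e / B"
    using Y e B(1) unfolding padic_cauchy_def by (meson divide_pos_pos)
  obtain K where K: "\<And>n. n \<ge> K \<Longrightarrow> A (X n) \<le> B \<and> A (Y n) \<le> C"
    using eventually_conj[OF B(2) C(2)] unfolding eventually_at_top_linorder by blast
  have "A (X m * Y m - X n * Y n) < e"
    if m: "m \<ge> max K (max M N)" and n: "n \<ge> max K (max M N)" for m n
  proof -
    have "A (X m * (Y m - Y n)) < e"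
    proof -
      have "A (X m) * A (Y m - Y n) \<le> B * A (Y m - Y n)"
        using K[of m] m by (intro mult_right_mono) auto
      also have "\<dots> < e" using N[of m n] m n B(1) by (simp add: field_simps)
      finally show ?thesis by (simp add: rat_padic_abs_mult)
    qed
    moreover have "A ((X m - X n) * Y n) < e"
    proof -
      have "A (X m - X n) * A (Y n) \<le> A (X m - X n) * C"
        using K[of n] n by (intro mult_left_mono) auto
      also have "\<dots> < e" using M[of m n] m n C(1) by (simp add: field_simps)
      finally show ?thesis by (simp add: rat_padic_abs_mult)
    qed
    ultimately show ?thesis
      using rat_padic_abs_ultrametric[of "X m * (Y m - Y n)" "(X m - X n) * Y n"]
      by (simp add: mult_diff_mult)
  qed
  then show "\<exists>N. \<forall>m\<ge>N. \<forall>n\<ge>N. A (X m * Y m - X n * Y n) < e" by blast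
qed

lemma padic_cauchy_abs_convergent:
  assumes "padic_cauchy p X"
  shows "convergent (\<lambda>n. rat_padic_abs p (X n))"
proof -
  have "Cauchy (\<lambda>n. A (X n))"
    unfolding Cauchy_def dist_real_def
    using assms rat_padic_abs_triangle_reverse unfolding padic_cauchy_def
    by (meson le_less_trans)
  then show ?thesis by (simp add: Cauchy_convergent_iff)
qed

lemma padic_cauchy_not_null:
  assumes X: "padic_cauchy p X" and nz: "\<not> padic_null p X"
  obtains b where "b > 0" "\<forall>\<^sub>F n in sequentially. b \<le> A (X n)"
proof -
  obtain L where L: "(\<lambda>n. A (X n)) \<longlonglongrightarrow> L"
    using padic_cauchy_abs_convergent[OF X] by (auto simp: convergent_def)
  have "L \<ge> 0" by (rule tendsto_lowerbound[OF L]) auto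
  moreover have "L \<noteq> 0" using nz L by (auto simp: padic_null_def)
  ultimately have "L > 0" by simp
  then have "\<forall>\<^sub>F n in sequentially. L / 2 < A (X n)"
    using order_tendstoD(1)[OF L, of "L / 2"] by simp
  then show ?thesis using that[of "L / 2"] \<open>L > 0\<close>
    by (metis (mono_tags, lifting) eventually_mono half_gt_zero less_imp_le)
qed

lemma padic_cauchy_inverse:
  assumes X: "padic_cauchy p X" and nz: "\<not> padic_null p X"
  shows "padic_cauchy p (\<lambda>n. inverse (X n))"
  unfolding padic_cauchy_def
proof (intro allI impI)
  fix e :: real assume e: "e > 0"
  obtain b where b: "b > 0" "\<forall>\<^sub>F n in sequentially. b \<le> A (X n)"
    by (rule padic_cauchy_not_null[OF X nz])
  obtain K where K: "\<And>n. n \<ge> K \<Longrightarrow> b \<le> A (X n)"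
    using b(2) unfolding eventually_at_top_linorder by blast
  have "e * (b * b) > 0" using e b(1) by simp
  then obtain M where M: "\<And>m n. m \<ge> M \<Longrightarrow> n \<ge> M \<Longrightarrow> A (X m - X n) < e * (b * b)"
    using X unfolding padic_cauchy_def by meson
  have "A (inverse (X m) - inverse (X n)) < e" if m: "m \<ge> max K M" and n: "n \<ge> max K M" for m n
  proof -
    have bm: "b \<le> A (X m)" and bn: "b \<le> A (X n)" using K m n by auto
    then have nz: "X m \<noteq> 0" "X n \<noteq> 0" using b(1) by auto
    have "A (inverse (X m) - inverse (X n)) = A (X m - X n) / (A (X m) * A (X n))"
      unfolding inverse_diff_inverse[OF nz]
      by (simp add: rat_padic_abs_mult rat_padic_abs_inverse divide_inverse)
    also have "\<dots> \<le> A (X m - X n) / (b * b)"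
      using bm bn b(1) by (intro divide_left_mono mult_mono mult_pos_pos) auto
    also have "\<dots> < e" using M[of m n] m n b(1) by (simp add: divide_less_eq)
    finally show ?thesis .
  qed
  then show "\<exists>N. \<forall>m\<ge>N. \<forall>n\<ge>N. A (inverse (X m) - inverse (X n)) < e" by blast
qed

lemma padic_null_diff_inverse:
  assumes X: "padic_cauchy p X" "\<not> padic_null p X"
    and Y: "padic_cauchy p Y" "\<not> padic_null p Y"
    and XY: "padic_null p (\<lambda>n. X n - Y n)"
  shows "padic_null p (\<lambda>n. inverse (X n) - inverse (Y n))"
proof -
  obtain B where B: "\<forall>\<^sub>F n in sequentially. A (inverse (X n)) \<le> B"
    by (rule padic_cauchy_bounded[OF padic_cauchy_inverse[OF X]])
  obtain C where C: "\<forall>\<^sub>F n in sequentially. A (inverse (Y n)) \<le> C"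
    by (rule padic_cauchy_bounded[OF padic_cauchy_inverse[OF Y]])
  have "padic_null p (\<lambda>n. - (((X n - Y n) * inverse (X n)) * inverse (Y n)))"
    by (intro padic_null_minus padic_null_mult_bounded[OF _ C] padic_null_mult_bounded[OF _ B] XY)
  moreover obtain b where b: "b > 0" "\<forall>\<^sub>F n in sequentially. b \<le> A (X n)"
    by (rule padic_cauchy_not_null[OF X])
  obtain c where c: "c > 0" "\<forall>\<^sub>F n in sequentially. c \<le> A (Y n)"
    by (rule padic_cauchy_not_null[OF Y])
  have "\<forall>\<^sub>F n in sequentially.
      A (- (((X n - Y n) * inverse (X n)) * inverse (Y n))) = A (inverse (X n) - inverse (Y n))"
    using b(2) c(2)
  proof eventually_elim
    case (elim n)
    then have "X n \<noteq> 0" "Y n \<noteq> 0" using b(1) c(1) by auto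
    then show ?case by (simp add: inverse_diff_inverse mult_ac)
  qed
  ultimately show ?thesis
    unfolding padic_null_def using tendsto_cong by fastforce
qed

end


section \<open>The field of \<open>p\<close>-adic numbers\<close>

text \<open>
  The prime is carried by a type argument: \<open>p = CARD('p)\<close>.  The field is constructed as the
  completion of the rationals with respect to the \<open>p\<close>-adic absolute value, i.e.\ as Cauchy
  sequences modulo null sequences.  (The command \<open>quotient_type\<close> does not support a relation
  depending on a type parameter that does not occur in the raw type, hence the manual \<open>typedef\<close>.)
\<close>

definition padicrel :: "'p::prime_card itself \<Rightarrow> (nat \<Rightarrow> rat) \<Rightarrow> (nat \<Rightarrow> rat) \<Rightarrow> bool" where
  "padicrel _ X Y \<longleftrightarrow>
     padic_cauchy CARD('p) X \<and> padic_cauchy CARD('p) Y \<and> padic_null CARD('p) (\<lambda>n. X n - Y n)"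

lemma padicrel_refl:
  "padic_cauchy CARD('p) X \<Longrightarrow> padicrel TYPE('p::prime_card) X X"
  by (simp add: padicrel_def padic_null_def)

lemma part_equivp_padicrel: "part_equivp (padicrel TYPE('p::prime_card))"
proof (rule part_equivpI)
  show "\<exists>X. padicrel TYPE('p) X X"
    using padicrel_refl padic_cauchy_const[OF prime_card] by blast
  show "symp (padicrel TYPE('p))"
  proof (rule sympI)
    fix X Y assume XY: "padicrel TYPE('p) X Y"
    then have "padic_null CARD('p) (\<lambda>n. - (X n - Y n))"
      unfolding padicrel_def by (intro padic_null_minus[OF prime_card]) simp
    then show "padicrel TYPE('p) Y X" using XY by (simp add: padicrel_def)
  qed
  show "transp (padicrel TYPE('p))"
  proof (rule transpI)
    fix X Y Z assume XY: "padicrel TYPE('p) X Y" and YZ: "padicrel TYPE('p) Y Z"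
    have "padic_null CARD('p) (\<lambda>n. (X n - Y n) + (Y n - Z n))"
      using XY YZ unfolding padicrel_def by (intro padic_null_add[OF prime_card]) simp_all
    then show "padicrel TYPE('p) X Z" using XY YZ by (simp add: padicrel_def)
  qed
qed

typedef (overloaded) 'p padic =
  "{C. \<exists>X. padicrel TYPE('p::prime_card) X X \<and> C = Collect (padicrel TYPE('p) X)}"
  morphisms padic_class Abs_padic
  using padicrel_refl[OF padic_cauchy_const[OF prime_card[where 'a='p]]] by blast

definition Padic :: "(nat \<Rightarrow> rat) \<Rightarrow> 'p::prime_card padic" where
  "Padic X = Abs_padic (Collect (padicrel TYPE('p) X))"

definition rep_padic :: "'p::prime_card padic \<Rightarrow> nat \<Rightarrow> rat" where
  "rep_padic x = (SOME X. X \<in> padic_class x)"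

definition cr_padic :: "(nat \<Rightarrow> rat) \<Rightarrow> 'p::prime_card padic \<Rightarrow> bool" where
  "cr_padic X x \<longleftrightarrow> padicrel TYPE('p) X X \<and> Padic X = x"

lemma Quotient_padic:
  "Quotient (padicrel TYPE('p::prime_card)) Padic rep_padic (cr_padic :: _ \<Rightarrow> 'p padic \<Rightarrow> bool)"
proof -
  interpret quot_type "padicrel TYPE('p)" "Abs_padic :: _ \<Rightarrow> 'p padic" padic_class
  proof
    show "part_equivp (padicrel TYPE('p))" by (rule part_equivp_padicrel)
    show "\<exists>X. padicrel TYPE('p) X X \<and> padic_class x = Collect (padicrel TYPE('p) X)"
      for x :: "'p padic"
      using padic_class[of x] by auto
    show "Abs_padic (padic_class x) = x" for x :: "'p padic"
      by (rule padic_class_inverse)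
    show "padic_class (Abs_padic C :: 'p padic) = C"
      if "\<exists>X. padicrel TYPE('p) X X \<and> C = Collect (padicrel TYPE('p) X)" for C
      using that by (intro Abs_padic_inverse) auto
    show "(padic_class x = padic_class y) = (x = y)" for x y :: "'p padic"
      by (rule padic_class_inject)
  qed
  have "Quotient3 (padicrel TYPE('p)) Padic (rep_padic :: 'p padic \<Rightarrow> _)"
  proof -
    have "abs = (Padic :: _ \<Rightarrow> 'p padic)" by (simp add: fun_eq_iff abs_def Padic_def)
    moreover have "rep = (rep_padic :: 'p padic \<Rightarrow> _)" by (simp add: fun_eq_iff rep_def rep_padic_def)
    ultimately show ?thesis using Quotient by simp
  qed
  then show ?thesis
    by (rule Quotient3_to_Quotient) (intro eq_reflection ext, rule cr_padic_def)
qed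

setup_lifting Quotient_padic

instantiation padic :: (prime_card) field
begin

lift_definition zero_padic :: "'a padic" is "\<lambda>_. 0"
  by (intro padicrel_refl padic_cauchy_const[OF prime_card])

lift_definition one_padic :: "'a padic" is "\<lambda>_. 1"
  by (intro padicrel_refl padic_cauchy_const[OF prime_card])

lift_definition plus_padic :: "'a padic \<Rightarrow> 'a padic \<Rightarrow> 'a padic" is "\<lambda>X Y n. X n + Y n"
  unfolding padicrel_def add_diff_add
  using padic_cauchy_add[OF prime_card] padic_null_add[OF prime_card] by blast

lift_definition uminus_padic :: "'a padic \<Rightarrow> 'a padic" is "\<lambda>X n. - X n"
  unfolding padicrel_def minus_diff_minus
  using padic_cauchy_minus[OF prime_card] padic_null_minus[OF prime_card] by blast

lift_definition times_padic :: "'a padic \<Rightarrow> 'a padic \<Rightarrow> 'a padic" is "\<lambda>X Y n. X n * Y n"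
proof -
  note pc = prime_card[where 'a='a]
  fix f1 f2 f3 f4
  assume "padicrel TYPE('a) f1 f2" "padicrel TYPE('a) f3 f4"
  then have c: "padic_cauchy CARD('a) f1" "padic_cauchy CARD('a) f2"
      "padic_cauchy CARD('a) f3" "padic_cauchy CARD('a) f4"
    and n: "padic_null CARD('a) (\<lambda>n. f1 n - f2 n)" "padic_null CARD('a) (\<lambda>n. f3 n - f4 n)"
    by (auto simp: padicrel_def)
  obtain B where B: "\<forall>\<^sub>F n in sequentially. rat_padic_abs CARD('a) (f1 n) \<le> B"
    by (rule padic_cauchy_bounded[OF pc c(1)])
  obtain C where C: "\<forall>\<^sub>F n in sequentially. rat_padic_abs CARD('a) (f4 n) \<le> C"
    by (rule padic_cauchy_bounded[OF pc c(4)])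
  have "padic_null CARD('a) (\<lambda>n. (f3 n - f4 n) * f1 n + (f1 n - f2 n) * f4 n)"
    by (intro padic_null_add[OF pc] padic_null_mult_bounded[OF pc _ B]
        padic_null_mult_bounded[OF pc _ C] n)
  moreover have "(\<lambda>n. (f3 n - f4 n) * f1 n + (f1 n - f2 n) * f4 n)
      = (\<lambda>n. f1 n * f3 n - f2 n * f4 n)"
    by (simp add: algebra_simps)
  ultimately show "padicrel TYPE('a) (\<lambda>n. f1 n * f3 n) (\<lambda>n. f2 n * f4 n)"
    using padic_cauchy_mult[OF pc] c by (simp add: padicrel_def)
qed

lemma padicrel_null_iff:
  assumes "padicrel TYPE('a) X Y"
  shows "padic_null CARD('a) X \<longleftrightarrow> padic_null CARD('a) Y"
proof -
  note pc = prime_card[where 'a='a]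
  have XY: "padic_null CARD('a) (\<lambda>n. X n - Y n)" using assms by (simp add: padicrel_def)
  show ?thesis
    using padic_null_add[OF pc XY, of Y]
      padic_null_add[OF pc padic_null_minus[OF pc XY], of X] by auto
qed

lift_definition inverse_padic :: "'a padic \<Rightarrow> 'a padic"
  is "\<lambda>X. if padic_null CARD('a) X then (\<lambda>_. 0) else (\<lambda>n. inverse (X n))"
proof -
  note pc = prime_card[where 'a='a]
  fix X Y assume XY: "padicrel TYPE('a) X Y"
  show "padicrel TYPE('a)
      (if padic_null CARD('a) X then (\<lambda>_. 0) else (\<lambda>n. inverse (X n)))
      (if padic_null CARD('a) Y then (\<lambda>_. 0) else (\<lambda>n. inverse (Y n)))"
  proof (cases "padic_null CARD('a) X")
    case True
    then show ?thesis
      using padicrel_null_iff[OF XY] padicrel_refl[OF padic_cauchy_const[OF pc]] by simp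
  next
    case False
    then have "\<not> padic_null CARD('a) Y" using padicrel_null_iff[OF XY] by simp
    then show ?thesis
      using False XY padic_cauchy_inverse[OF pc] padic_null_diff_inverse[OF pc]
      by (simp add: padicrel_def)
  qed
qed

definition minus_padic :: "'a padic \<Rightarrow> 'a padic \<Rightarrow> 'a padic" where
  "x - y = x + - y" for x y :: "'a padic"

definition divide_padic :: "'a padic \<Rightarrow> 'a padic \<Rightarrow> 'a padic" where
  "x div y = x * inverse y" for x y :: "'a padic"

instance
proof
  note pc = prime_card[where 'a='a]
  fix a b c :: "'a padic"
  show "a + b + c = a + (b + c)"
    by transfer (auto simp: padicrel_def padic_null_def add.assoc intro!: padic_cauchy_add[OF pc])
  show "a + b = b + a"
    by transfer (auto simp: padicrel_def padic_null_def add.commute intro!: padic_cauchy_add[OF pc])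
  show "0 + a = a"
    by transfer (auto simp: padicrel_def padic_null_def)
  show "- a + a = 0"
    by transfer (auto simp: padicrel_def padic_null_def intro!: padic_cauchy_const[OF pc])
  show "a - b = a + - b"
    by (rule minus_padic_def)
  show "a * b * c = a * (b * c)"
    by transfer (auto simp: padicrel_def padic_null_def mult.assoc intro!: padic_cauchy_mult[OF pc])
  show "a * b = b * a"
    by transfer (auto simp: padicrel_def padic_null_def mult.commute intro!: padic_cauchy_mult[OF pc])
  show "1 * a = a"
    by transfer (auto simp: padicrel_def padic_null_def)
  show "(a + b) * c = a * c + b * c"
    by transfer (auto simp: padicrel_def padic_null_def distrib_right
        intro!: padic_cauchy_mult[OF pc] padic_cauchy_add[OF pc])
  show "(0 :: 'a padic) \<noteq> 1"
    by transfer (simp add: padicrel_def padic_null_def rat_padic_abs_one[OF pc]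
        rat_padic_abs_minus[OF pc] LIMSEQ_const_iff)
  show "a \<noteq> 0 \<Longrightarrow> inverse a * a = 1"
  proof transfer
    fix X assume X: "padicrel TYPE('a) X X" and nz: "\<not> padicrel TYPE('a) X (\<lambda>_. 0)"
    have cX: "padic_cauchy CARD('a) X" using X by (simp add: padicrel_def)
    have nX: "\<not> padic_null CARD('a) X"
      using nz cX padic_cauchy_const[OF pc] by (simp add: padicrel_def)
    obtain b where b: "b > 0" "\<forall>\<^sub>F n in sequentially. b \<le> rat_padic_abs CARD('a) (X n)"
      by (rule padic_cauchy_not_null[OF pc cX nX])
    have "\<forall>\<^sub>F n in sequentially. rat_padic_abs CARD('a) (inverse (X n) * X n - 1) = 0"
      using b(2)
    proof eventually_elim
      case (elim n)
      then have "X n \<noteq> 0" using b(1) by auto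
      then show ?case by simp
    qed
    then have "padic_null CARD('a) (\<lambda>n. inverse (X n) * X n - 1)"
      unfolding padic_null_def by (rule tendsto_eventually)
    then show "padicrel TYPE('a)
        (\<lambda>n. (if padic_null CARD('a) X then \<lambda>_. 0 else (\<lambda>n. inverse (X n))) n * X n) (\<lambda>_. 1)"
      using nX cX padic_cauchy_inverse[OF pc] padic_cauchy_mult[OF pc] padic_cauchy_const[OF pc]
      by (simp add: padicrel_def)
  qed
  show "a div b = a * inverse b"
    by (rule divide_padic_def)
  show "inverse (0 :: 'a padic) = 0"
    by transfer (simp add: padicrel_def padic_null_def padic_cauchy_const[OF pc])
qed

end


section \<open>Absolute value, metric and topology\<close>

text \<open>The continuous extension of the \<open>p\<close>-adic absolute value to the completion.\<close>

lift_definition padic_norm :: "'a::prime_card padic \<Rightarrow> real"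
  is "\<lambda>X. lim (\<lambda>n. rat_padic_abs CARD('a) (X n))"
proof -
  note pc = prime_card[where 'a='a]
  fix X Y assume XY: "padicrel TYPE('a) X Y"
  obtain L where L: "(\<lambda>n. rat_padic_abs CARD('a) (Y n)) \<longlonglongrightarrow> L"
    using XY padic_cauchy_abs_convergent[OF pc] by (auto simp: padicrel_def convergent_def)
  have "(\<lambda>n. rat_padic_abs CARD('a) (X n - Y n)) \<longlonglongrightarrow> 0"
    using XY by (simp add: padicrel_def padic_null_def)
  then have "(\<lambda>n. rat_padic_abs CARD('a) (X n) - rat_padic_abs CARD('a) (Y n)) \<longlonglongrightarrow> 0"
    by (rule Lim_null_comparison[rotated])
       (simp add: rat_padic_abs_triangle_reverse[OF pc])
  from tendsto_add[OF this L] have "(\<lambda>n. rat_padic_abs CARD('a) (X n)) \<longlonglongrightarrow> L" by simp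
  with L show "lim (\<lambda>n. rat_padic_abs CARD('a) (X n)) = lim (\<lambda>n. rat_padic_abs CARD('a) (Y n))"
    by (simp add: limI)
qed

lemma padic_norm_LIMSEQ:
  "padic_cauchy CARD('a::prime_card) X \<Longrightarrow>
     (\<lambda>n. rat_padic_abs CARD('a) (X n)) \<longlonglongrightarrow> lim (\<lambda>n. rat_padic_abs CARD('a) (X n))"
  using padic_cauchy_abs_convergent[OF prime_card] convergent_LIMSEQ_iff by blast

lemma padic_norm_eq_0_iff: "padic_norm x = 0 \<longleftrightarrow> x = 0" for x :: "'a::prime_card padic"
proof transfer
  note pc = prime_card[where 'a='a]
  fix X assume "padicrel TYPE('a) X X"
  then have X: "padic_cauchy CARD('a) X" by (simp add: padicrel_def)
  show "lim (\<lambda>n. rat_padic_abs CARD('a) (X n)) = 0 \<longleftrightarrow> padicrel TYPE('a) X (\<lambda>_. 0)"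
    using padic_norm_LIMSEQ[OF X] X padic_cauchy_const[OF pc] limI
    by (auto simp: padicrel_def padic_null_def)
qed

lemma padic_norm_minus: "padic_norm (- x) = padic_norm x" for x :: "'a::prime_card padic"
  by transfer (simp add: rat_padic_abs_minus[OF prime_card])

lemma padic_norm_mult: "padic_norm (x * y) = padic_norm x * padic_norm y"
  for x y :: "'a::prime_card padic"
proof transfer
  note pc = prime_card[where 'a='a]
  fix X Y assume "padicrel TYPE('a) X X" "padicrel TYPE('a) Y Y"
  then have "padic_cauchy CARD('a) X" "padic_cauchy CARD('a) Y" by (auto simp: padicrel_def)
  from tendsto_mult[OF this[THEN padic_norm_LIMSEQ]]
  show "lim (\<lambda>n. rat_padic_abs CARD('a) (X n * Y n)) =
      lim (\<lambda>n. rat_padic_abs CARD('a) (X n)) * lim (\<lambda>n. rat_padic_abs CARD('a) (Y n))"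
    by (simp add: rat_padic_abs_mult[OF pc] limI)
qed

lemma padic_norm_ultrametric: "padic_norm (x + y) \<le> max (padic_norm x) (padic_norm y)"
  for x y :: "'a::prime_card padic"
proof transfer
  note pc = prime_card[where 'a='a]
  fix X Y assume "padicrel TYPE('a) X X" "padicrel TYPE('a) Y Y"
  then have X: "padic_cauchy CARD('a) X" and Y: "padic_cauchy CARD('a) Y"
    by (auto simp: padicrel_def)
  show "lim (\<lambda>n. rat_padic_abs CARD('a) (X n + Y n)) \<le>
      max (lim (\<lambda>n. rat_padic_abs CARD('a) (X n))) (lim (\<lambda>n. rat_padic_abs CARD('a) (Y n)))"
    by (rule LIMSEQ_le[OF padic_norm_LIMSEQ[OF padic_cauchy_add[OF pc X Y]]
          tendsto_max[OF padic_norm_LIMSEQ[OF X] padic_norm_LIMSEQ[OF Y]]])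
       (use rat_padic_abs_ultrametric[OF pc] in blast)
qed

lemma padic_norm_nonneg: "0 \<le> padic_norm x" for x :: "'a::prime_card padic"
proof -
  have "padic_norm (x + - x) \<le> max (padic_norm x) (padic_norm (- x))" by (rule padic_norm_ultrametric)
  then show ?thesis using padic_norm_minus[of x] padic_norm_eq_0_iff[of "0 :: 'a padic"] by simp
qed

instantiation padic :: (prime_card) metric_space
begin

definition dist_padic :: "'a padic \<Rightarrow> 'a padic \<Rightarrow> real" where
  "dist_padic x y = padic_norm (x - y)"

definition uniformity_padic :: "('a padic \<times> 'a padic) filter" where
  "uniformity_padic = (INF e\<in>{0 <..}. principal {(x, y). dist x y < e})"

definition open_padic :: "'a padic set \<Rightarrow> bool" where
  "open_padic U = (\<forall>x\<in>U. eventually (\<lambda>(x', y). x' = x \<longrightarrow> y \<in> U) uniformity)"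

instance
proof
  fix x y z :: "'a padic"
  show "dist x y = 0 \<longleftrightarrow> x = y"
    by (simp add: dist_padic_def padic_norm_eq_0_iff)
  have "padic_norm (x - y) \<le> max (padic_norm (x - z)) (padic_norm (z - y))"
    using padic_norm_ultrametric[of "x - z" "z - y"] by simp
  moreover have "padic_norm (z - y) = padic_norm (y - z)" using padic_norm_minus[of "y - z"] by simp
  ultimately show "dist x y \<le> dist x z + dist y z"
    unfolding dist_padic_def using padic_norm_nonneg[of "x - z"] padic_norm_nonneg[of "y - z"]
    by linarith
qed (simp_all add: uniformity_padic_def open_padic_def)

end

lemma of_nat_padic: "of_nat m = (Padic (\<lambda>_. of_nat m) :: 'p::prime_card padic)"
proof (induction m)
  case 0
  then show ?case by (simp add: zero_padic_def)
next
  case (Suc m)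
  have "padicrel TYPE('p) (\<lambda>_. q) (\<lambda>_. q)" for q
    by (intro padicrel_refl padic_cauchy_const[OF prime_card])
  then show ?case
    by (simp add: Suc.IH one_padic_def plus_padic.abs_eq)
qed

lemma padic_norm_of_nat:
  "padic_norm (of_nat m :: 'p::prime_card padic) = rat_padic_abs CARD('p) (of_nat m)"
  unfolding of_nat_padic
  by (subst padic_norm.abs_eq)
     (auto intro: padicrel_refl padic_cauchy_const[OF prime_card])

instance padic :: (prime_card) field_char_0
proof
  have "(of_nat m :: 'a padic) \<noteq> 0" if "m > 0" for m
    using that padic_norm_of_nat[of m, where 'p='a] padic_norm_eq_0_iff[of "of_nat m :: 'a padic"]
    by (simp add: rat_padic_abs_eq_0_iff[OF prime_card])
  then show "inj (of_nat :: nat \<Rightarrow> 'a padic)"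
    by (metis (no_types, lifting) add_left_cancel add.right_neutral injI less_imp_add_positive
        linorder_neqE_nat of_nat_add)
qed

lemma padic_norm_of_rat: "padic_norm (of_rat q :: 'p::prime_card padic) = rat_padic_abs CARD('p) q"
proof -
  note pc = prime_card[where 'a='p]
  have int: "padic_norm (of_int a :: 'p padic) = rat_padic_abs CARD('p) (of_int a)" for a
    by (cases a) (simp_all add: padic_norm_of_nat padic_norm_minus rat_padic_abs_minus[OF pc]
        del: of_nat_Suc)
  obtain a b where q: "quotient_of q = (a, b)" by fastforce
  then have b: "b > 0" and qq: "q = of_int a / of_int b"
    using quotient_of_denom_pos quotient_of_div by blast+
  have "q * of_int b = of_int a" using b qq by simp
  then have "of_rat q * (of_int b :: 'p padic) = of_int a"
    by (metis of_rat_mult of_rat_of_int_eq)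
  then have "padic_norm (of_rat q :: 'p padic) * rat_padic_abs CARD('p) (of_int b)
      = rat_padic_abs CARD('p) q * rat_padic_abs CARD('p) (of_int b)"
    by (metis int padic_norm_mult rat_padic_abs_mult[OF pc] \<open>q * of_int b = of_int a\<close>)
  then show ?thesis using b by (simp add: rat_padic_abs_eq_0_iff[OF pc])
qed

definition padic_integers :: "'p::prime_card padic set" where
  "padic_integers = {x. padic_norm x \<le> 1}"


section \<open>Self-similar sets and digit expansions\<close>

definition self_similar_map :: "nat \<Rightarrow> int \<Rightarrow> 'p::prime_card padic \<Rightarrow> 'p padic \<Rightarrow> 'p padic" where
  "self_similar_map b k d x = (- 1) ^ b * of_nat CARD('p) powi k * x + d"

text \<open>
  For finitely many contractions of a complete metric space (and a non-empty index set) exactly one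
  set has this property.
\<close>

definition is_self_similar_set :: "'i set \<Rightarrow> ('i \<Rightarrow> 'a::metric_space \<Rightarrow> 'a) \<Rightarrow> 'a set \<Rightarrow> bool" where
  "is_self_similar_set I F K \<longleftrightarrow> compact K \<and> K \<noteq> {} \<and> K = (\<Union>i\<in>I. F i ` K)"

definition padic_expansions :: "'p::prime_card padic set \<Rightarrow> (nat \<Rightarrow> nat) set" where
  "padic_expansions K =
     {c. (\<forall>i. c i < CARD('p)) \<and>
         (\<exists>x\<in>K. (\<lambda>i. of_nat (c i) * of_nat CARD('p) ^ i) sums x)}"


section \<open>Deterministic finite automata on infinite words\<close>

text \<open>All states are accepting, so there is no field for accepting states.\<close>

record 's automaton =
  states :: "'s set"
  initial :: 's
  trans :: "'s \<Rightarrow> nat \<Rightarrow> 's option"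

definition dfa :: "nat \<Rightarrow> 's automaton \<Rightarrow> bool" where
  "dfa p M \<longleftrightarrow> finite (states M) \<and> initial M \<in> states M \<and>
     (\<forall>q\<in>states M. \<forall>a q'. trans M q a = Some q' \<longrightarrow> a < p \<and> q' \<in> states M)"

definition recognized :: "'s automaton \<Rightarrow> (nat \<Rightarrow> nat) set" where
  "recognized M =
     {c. \<exists>r. r 0 = initial M \<and> (\<forall>i. trans M (r i) (c i) = Some (r (Suc i)))}"

definition state_graph :: "'s automaton \<Rightarrow> ('s \<times> 's) set" where
  "state_graph M = {(q, q'). q \<in> states M \<and> (\<exists>a. trans M q a = Some q')}"

text \<open>
  As usual for loop classes, the class is non-empty and paths have at least one edge; hence a
  single state forms a loop class only if it carries a loop.
\<close>

definition loop_class :: "'s automaton \<Rightarrow> 's set \<Rightarrow> bool" where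
  "loop_class M C \<longleftrightarrow> C \<noteq> {} \<and> C \<subseteq> states M \<and>
     (\<forall>q\<in>C. \<forall>q'\<in>C. (q, q') \<in> (state_graph M \<inter> C \<times> C)\<^sup>+)"

definition essential_class :: "'s automaton \<Rightarrow> 's set \<Rightarrow> bool" where
  "essential_class M C \<longleftrightarrow> loop_class M C \<and>
     (\<forall>D. loop_class M D \<and> C \<subseteq> D \<longrightarrow> D = C) \<and>
     (\<forall>q\<in>C. \<forall>q'. (q, q') \<in> (state_graph M)\<^sup>* \<longrightarrow> q' \<in> C)"

end

theory Submission
  imports Defs "HOL-Number_Theory.Residues"
begin

text \<open>
  The states are the non-empty residual sets \<open>{y \<in> \<int>\<^sub>p. w + p\<^sup>N y \<in> K}\<close>.  Such a set is a union of pieces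
  \<open>\<plusminus>p\<^sup>j K + t\<close> with \<open>j\<close> bounded, \<open>D t\<close> an integer for a common denominator \<open>D\<close>, and \<open>\<bar>t\<bar>\<close> bounded at the
  archimedean place, so there are finitely many of them; compactness of \<open>K\<close> gives the language.

  For uniqueness of the essential class any two states must have a common descendant.  Among the
  compositions \<open>f\<close> of the given maps, those for which \<open>S = f\<inverse>(K) \<inter> \<int>\<^sub>p\<close> is maximal satisfy
  \<open>(g f)\<inverse>(K) \<inter> \<int>\<^sub>p = S\<close> for every composition \<open>g\<close>.  By Euler's theorem \<open>g\<close> can be taken to be an
  iterate of the form \<open>p\<^sup>k x + e\<close> with \<open>e\<close> an integer, hence every state has a descendant \<open>\<plusminus>S + t\<close>, where
  the sign and \<open>t\<close> modulo the integers do not depend on the state.  Two residual sets that differ by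
  an integer translation \<open>c\<close> become equal further down: along a point \<open>x\<close> that is not one of the
  finitely many integers between \<open>0\<close> and \<open>c\<close>, the carry in \<open>x - c\<close> dies out.
\<close>

section \<open>Integers inside the \<open>p\<close>-adic integers\<close>

lemma padic_norm_of_int:
  "padic_norm (of_int z :: 'p::prime_card padic) = rat_padic_abs CARD('p) (of_int z)"
  using padic_norm_of_rat[of "of_int z", where 'p = 'p] by simp

lemma rat_padic_abs_of_int:
  assumes "prime p" "z \<noteq> 0"
  shows "rat_padic_abs p (of_int z) = 1 / real p ^ multiplicity (int p) z"
  using rat_padic_abs_divide[OF assms(1), of z 1] assms
  by (simp add: power_int_minus inverse_eq_divide)

lemma padic_norm_card: "padic_norm (of_nat CARD('p) :: 'p::prime_card padic) = 1 / real CARD('p)"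
proof -
  have p: "prime CARD('p)" by (rule prime_card)
  have "multiplicity (int CARD('p)) (int CARD('p)) = 1"
    using p by (intro multiplicity_self) (auto simp: prime_gt_0_nat)
  then show ?thesis
    using rat_padic_abs_of_int[OF p, of "int CARD('p)"] p
    by (simp add: padic_norm_of_nat)
qed

lemma padic_norm_power: "padic_norm (x ^ n) = padic_norm x ^ n" for x :: "'p::prime_card padic"
proof (induction n)
  case 0
  have "padic_norm (of_rat 1 :: 'p padic) = 1"
    unfolding padic_norm_of_rat by (rule rat_padic_abs_one[OF prime_card])
  then show ?case by simp
qed (simp add: padic_norm_mult)

lemma padic_norm_card_power:
  "padic_norm (of_nat CARD('p) ^ N :: 'p::prime_card padic) = 1 / real CARD('p) ^ N"
  by (simp add: padic_norm_power padic_norm_card power_divide)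

lemma padic_integers_add: "x \<in> padic_integers \<Longrightarrow> y \<in> padic_integers \<Longrightarrow> x + y \<in> padic_integers"
  using padic_norm_ultrametric[of x y] by (auto simp: padic_integers_def)

lemma padic_integers_minus: "x \<in> padic_integers \<Longrightarrow> - x \<in> padic_integers"
  by (simp add: padic_integers_def padic_norm_minus)

lemma padic_integers_diff: "x \<in> padic_integers \<Longrightarrow> y \<in> padic_integers \<Longrightarrow> x - y \<in> padic_integers"
  using padic_integers_add[OF _ padic_integers_minus, of x y] by simp

lemma padic_integers_mult: "x \<in> padic_integers \<Longrightarrow> y \<in> padic_integers \<Longrightarrow> x * y \<in> padic_integers"
  by (auto simp: padic_integers_def padic_norm_mult padic_norm_nonneg intro: mult_le_one)

lemma padic_integers_of_int: "of_int z \<in> padic_integers"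
proof (cases "z = 0")
  case False
  have "real CARD('a) \<ge> 1" using prime_card[where 'a = 'a] prime_ge_1_nat by force
  then have "1 / real CARD('a) ^ multiplicity (int CARD('a)) z \<le> 1" by simp
  then show ?thesis
    using rat_padic_abs_of_int[OF prime_card[where 'a = 'a] False]
    by (simp add: padic_integers_def padic_norm_of_int)
qed (simp add: padic_integers_def iffD2[OF padic_norm_eq_0_iff])

lemma padic_integers_of_nat: "of_nat n \<in> padic_integers"
  using padic_integers_of_int[of "int n"] by simp

lemma padic_integers_power: "x \<in> padic_integers \<Longrightarrow> x ^ n \<in> padic_integers"
  by (auto simp: padic_integers_def padic_norm_power padic_norm_nonneg intro: power_le_one)

lemmas padic_integers_intros = padic_integers_add padic_integers_diff padic_integers_minus
  padic_integers_mult padic_integers_of_int padic_integers_of_nat padic_integers_power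

lemma card_power_nonzero: "(of_nat CARD('p) :: 'p::prime_card padic) ^ N \<noteq> 0"
  using prime_card[where 'a = 'p] by (simp add: prime_gt_0_nat)

text \<open>Balls around 0 are the ideals generated by \<open>p ^ N\<close>. This translates between
  distances and digit blocks throughout.\<close>

lemma padic_norm_le_iff:
  "padic_norm x \<le> 1 / real CARD('p) ^ N \<longleftrightarrow> (\<exists>y\<in>padic_integers. x = of_nat CARD('p) ^ N * y)"
  for x :: "'p::prime_card padic"
proof
  have pos: "real CARD('p) ^ N > 0" using prime_card[where 'a = 'p] by (simp add: prime_gt_0_nat)
  assume le: "padic_norm x \<le> 1 / real CARD('p) ^ N"
  define y where "y = x / of_nat CARD('p) ^ N"
  have x: "x = of_nat CARD('p) ^ N * y" using card_power_nonzero[of N, where 'p = 'p] by (simp add: y_def)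
  have "padic_norm x = padic_norm y / real CARD('p) ^ N"
    by (subst x) (simp add: padic_norm_mult padic_norm_card_power)
  then have "padic_norm y \<le> 1" using le pos by (simp add: divide_le_cancel)
  then show "\<exists>y\<in>padic_integers. x = of_nat CARD('p) ^ N * y" using x by (auto simp: padic_integers_def)
next
  have pos: "real CARD('p) ^ N > 0" using prime_card[where 'a = 'p] by (simp add: prime_gt_0_nat)
  assume "\<exists>y\<in>padic_integers. x = of_nat CARD('p) ^ N * y"
  then show "padic_norm x \<le> 1 / real CARD('p) ^ N"
    using pos by (auto simp: padic_norm_mult padic_norm_card_power padic_integers_def divide_right_mono)
qed

text \<open>The norm of a non-zero integer is \<open>p ^ -m\<close> with \<open>m\<close> its
  multiplicity of \<open>p\<close>, so divisibility by \<open>p ^ N\<close> can be read off in the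
  p-adic integers.\<close>

lemma int_power_dvd_padic:
  fixes y :: "'p::prime_card padic"
  assumes "of_int z = of_nat CARD('p) ^ N * y" "y \<in> padic_integers"
  shows "int CARD('p) ^ N dvd z"
proof (cases "z = 0")
  case False
  let ?m = "multiplicity (int CARD('p)) z"
  have p: "prime CARD('p)" by (rule prime_card)
  have "padic_norm (of_int z :: 'p padic) \<le> 1 / real CARD('p) ^ N"
    unfolding padic_norm_le_iff using assms by blast
  then have "1 / real CARD('p) ^ ?m \<le> 1 / real CARD('p) ^ N"
    using rat_padic_abs_of_int[OF p False] by (simp add: padic_norm_of_int)
  then have "inverse (real CARD('p) ^ ?m) \<le> inverse (real CARD('p) ^ N)"
    by (simp only: inverse_eq_divide)
  then have "real CARD('p) ^ N \<le> real CARD('p) ^ ?m"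
    by (rule inverse_le_imp_le) (simp add: prime_gt_0_nat[OF p])
  moreover have "1 < real CARD('p)" using prime_gt_1_nat[OF p] by simp
  ultimately have "N \<le> ?m" by (rule power_le_imp_le_exp[rotated])
  then show ?thesis by (rule multiplicity_dvd')
qed simp

text \<open>\<open>Z[1/p]\<close> meets the p-adic integers in \<open>Z\<close>: by the previous
  lemma the power of \<open>p\<close> already divides the integer.\<close>

lemma padic_eq_of_int:
  fixes y :: "'p::prime_card padic"
  assumes "of_nat CARD('p) ^ N * y \<in> \<int>" "y \<in> padic_integers"
  shows "y \<in> \<int>"
proof -
  obtain z where z: "of_nat CARD('p) ^ N * y = of_int z" using assms(1) by (rule Ints_cases)
  then obtain z' where "z = int CARD('p) ^ N * z'"
    using int_power_dvd_padic[of z N y] assms(2) by (auto elim: dvdE)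
  then have "of_nat CARD('p) ^ N * y = of_nat CARD('p) ^ N * of_int z'" using z by simp
  then show ?thesis using card_power_nonzero[of N, where 'p = 'p] by simp
qed

text \<open>An integer prime to \<open>p\<close> has norm 1.\<close>

lemma padic_integers_cancel_coprime:
  fixes y :: "'p::prime_card padic"
  assumes "of_int D * y \<in> padic_integers" "coprime D (int CARD('p))"
  shows "y \<in> padic_integers"
proof -
  have p: "prime CARD('p)" by (rule prime_card)
  have ndvd: "\<not> int CARD('p) dvd D"
    using assms(2) p by (metis coprime_absorb_right not_prime_unit prime_nat_int_transfer)
  then have "D \<noteq> 0" by auto
  moreover have "multiplicity (int CARD('p)) D = 0"
    using ndvd by (rule not_dvd_imp_multiplicity_0)
  ultimately have "padic_norm (of_int D :: 'p padic) = 1"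
    using rat_padic_abs_of_int[OF p, of D] by (simp add: padic_norm_of_int)
  then show ?thesis using assms(1) by (simp add: padic_integers_def padic_norm_mult)
qed

text \<open>Take the reduced denominator: if \<open>p\<close> divided it, then
  \<open>a = b * x\<close> with \<open>x\<close> p-adically integral would make \<open>p\<close>
  divide the numerator too.\<close>

lemma rational_padic_integer:
  fixes x :: "'p::prime_card padic"
  assumes "x \<in> padic_integers" "x \<in> \<rat>"
  obtains D where "D > 0" "coprime D (int CARD('p))" "of_int D * x \<in> \<int>"
proof -
  have p: "prime (int CARD('p))" using prime_card[where 'a = 'p] by simp
  obtain a b where b: "b > 0" and ab: "coprime a b" and x: "x = of_int a / of_int b"
    using assms(2) by (rule Rats_cases')
  have a: "of_int a = of_int b * x" using b x by simp
  have "\<not> int CARD('p) dvd b"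
  proof
    assume dvd: "int CARD('p) dvd b"
    then obtain c where "b = int CARD('p) * c" by (auto elim: dvdE)
    then have "of_int a = of_nat CARD('p) ^ 1 * (of_int c * x)" using a by simp
    then have "int CARD('p) ^ 1 dvd a"
      by (rule int_power_dvd_padic) (intro padic_integers_intros assms)
    then show False using dvd ab p by (metis coprime_common_divisor not_prime_unit power_one_right)
  qed
  then have "coprime b (int CARD('p))"
    using prime_imp_coprime[OF p] coprime_commute by blast
  then show thesis using that[OF b] a by (metis Ints_of_int)
qed

section \<open>Finite digit blocks\<close>

text \<open>The denominator \<open>D\<close> is invertible modulo \<open>p ^ N\<close>, so
  \<open>w\<close> is found by solving \<open>D * w = \<epsilon>\<close> modulo
  \<open>p ^ N\<close>. For the remainder, \<open>of_int D * y\<close> is an integer, and the factor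
  \<open>D\<close> can be cancelled.\<close>

lemma nat_approximation:
  fixes e :: "'p::prime_card padic"
  assumes D: "coprime D (int CARD('p))" and e: "of_int D * e \<in> \<int>"
  obtains w y where "w < CARD('p) ^ N" "y \<in> padic_integers" "e = of_nat w + of_nat CARD('p) ^ N * y"
proof -
  let ?q = "int CARD('p) ^ N"
  have q: "?q > 0" using prime_card[where 'a = 'p] by (simp add: prime_gt_0_nat)
  obtain \<epsilon> where \<epsilon>: "of_int D * e = of_int \<epsilon>" using e by (rule Ints_cases)
  have "coprime D ?q" using D by simp
  then obtain x where x: "[D * x = \<epsilon>] (mod ?q)"
    using cong_solve_coprime_int cong_scalar_right[of "D * _" 1 ?q \<epsilon>] by (metis mult.assoc mult_1)
  define w where "w = x mod ?q"
  have w: "0 \<le> w" "w < ?q" using q by (auto simp: w_def)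
  have "[D * w = \<epsilon>] (mod ?q)" using x by (simp add: w_def cong_def mod_mult_right_eq)
  then obtain z where z: "\<epsilon> - D * w = ?q * z" by (metis cong_iff_dvd_diff cong_sym dvdE)
  define y where "y = (e - of_int w) / of_nat CARD('p) ^ N"
  have ey: "e = of_int w + of_nat CARD('p) ^ N * y"
    using card_power_nonzero[of N, where 'p = 'p] by (simp add: y_def)
  have "of_nat CARD('p) ^ N * (of_int D * y) = of_int D * e - of_int D * of_int w"
    by (subst ey) (simp add: algebra_simps)
  also have "\<dots> = of_int (\<epsilon> - D * w)" by (simp add: \<epsilon>)
  also have "\<dots> = of_nat CARD('p) ^ N * of_int z" by (simp add: z)
  finally have "of_int D * y = of_int z" using card_power_nonzero[of N, where 'p = 'p] by simp
  then have "y \<in> padic_integers"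
    using padic_integers_cancel_coprime[OF _ D] padic_integers_of_int by metis
  moreover have "nat w < CARD('p) ^ N" using w by (simp add: nat_less_iff)
  moreover have "e = of_nat (nat w) + of_nat CARD('p) ^ N * y" using ey w by simp
  ultimately show thesis using that by blast
qed

text \<open>The bounds on \<open>w\<close> and \<open>v\<close> put the quotient
  \<open>(v - w) / p ^ N\<close> between 0 and \<open>p ^ m\<close>; so \<open>w\<close> consists of
  the lowest \<open>N\<close> digits of \<open>v\<close>, and \<open>z\<close> of the other
  \<open>m\<close>.\<close>

lemma split_digits:
  fixes z :: "'p::prime_card padic"
  assumes eq: "of_nat v = of_nat w + of_nat CARD('p) ^ N * z" and z: "z \<in> padic_integers"
    and w: "w < CARD('p) ^ N" and v: "v < CARD('p) ^ (N + m)"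
  obtains u where "u < CARD('p) ^ m" "z = of_nat u" "v = w + CARD('p) ^ N * u"
proof -
  let ?q = "int CARD('p)"
  have q: "?q ^ N > 0" using prime_card[where 'a = 'p] by (simp add: prime_gt_0_nat)
  have eq': "of_int (int v - int w) = of_nat CARD('p) ^ N * z" using eq by simp
  then have "?q ^ N dvd int v - int w" using z by (rule int_power_dvd_padic)
  then obtain u where u: "int v - int w = ?q ^ N * u" by (rule dvdE)
  have "of_nat CARD('p) ^ N * z = of_nat CARD('p) ^ N * of_int u" using eq' u by simp
  then have zu: "z = of_int u" using card_power_nonzero[of N, where 'p = 'p] by simp
  \<comment> \<open>As \<open>w < p ^ N\<close>, the difference \<open>v - w\<close> exceeds
    \<open>- p ^ N\<close>, which leaves no room for a negative \<open>u\<close>.\<close>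
  have "?q ^ N * (- 1) < ?q ^ N * u" using w u by (simp flip: of_nat_power)
  then have u0: "u \<ge> 0" using q by (simp only: mult_less_cancel_left_pos)
  have "int v < ?q ^ N * ?q ^ m" using v by (simp add: power_add flip: of_nat_power of_nat_mult)
  then have "?q ^ N * u < ?q ^ N * ?q ^ m" using u by linarith
  then have "u < ?q ^ m" using q by (simp only: mult_less_cancel_left_pos)
  then have "nat u < CARD('p) ^ m" using u0 by (simp add: nat_less_iff)
  moreover have "int v = int (w + CARD('p) ^ N * nat u)" using u u0 by simp
  then have "v = w + CARD('p) ^ N * nat u" by (simp only: of_nat_eq_iff)
  moreover have "z = of_nat (nat u)" using zu u0 by simp
  ultimately show thesis using that by blast
qed

lemma join_digits:
  assumes "w < q ^ N" "u < (q::nat) ^ m"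
  shows "w + q ^ N * u < q ^ (N + m)"
proof -
  have "w + q ^ N * u < q ^ N * (u + 1)" using assms(1) by simp
  also have "\<dots> \<le> q ^ N * q ^ m" using assms(2) by (intro mult_left_mono) auto
  finally show ?thesis by (simp add: power_add)
qed

section \<open>Unique essential class of a confluent automaton\<close>

text \<open>Merge the members one after another: confluence joins the successor found so far with
  the next member.\<close>

lemma common_successor_of_finite_set:
  assumes "finite A" "A \<noteq> {}" "A \<subseteq> V"
    and closed: "E \<subseteq> V \<times> V"
    and conf: "\<And>q q'. q \<in> V \<Longrightarrow> q' \<in> V \<Longrightarrow> \<exists>r. (q, r) \<in> E\<^sup>* \<and> (q', r) \<in> E\<^sup>*"
  shows "\<exists>r\<in>V. \<forall>q\<in>A. (q, r) \<in> E\<^sup>*"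
  using assms(1-3)
proof (induction A rule: finite_ne_induct)
  case (singleton q)
  then show ?case by auto
next
  case (insert q A)
  then obtain r where r: "r \<in> V" "\<forall>q\<in>A. (q, r) \<in> E\<^sup>*" by auto
  obtain r' where r': "(q, r') \<in> E\<^sup>*" "(r, r') \<in> E\<^sup>*" using conf insert.prems r(1) by blast
  have "r' \<in> V" using r'(2) r(1) closed by (induction rule: rtrancl_induct) auto
  moreover have "(s, r') \<in> E\<^sup>*" if "s \<in> A" for s using r(2) r'(2) that by (blast intro: rtrancl_trans)
  ultimately show ?case using r'(1) by blast
qed

text \<open>The class is the set \<open>C\<close> of states reachable from every state. Finiteness
  and confluence make it non-empty, and it is closed under edges and strongly connected. Another
  essential class \<open>L\<close> is closed, hence contains \<open>C\<close>, and maximality of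
  \<open>C\<close> gives equality.\<close>

lemma unique_essential_class:
  fixes M :: "'s automaton"
  assumes M: "dfa p M"
    and succ: "\<And>q. q \<in> states M \<Longrightarrow> \<exists>q'. (q, q') \<in> state_graph M"
    and conf: "\<And>q q'. q \<in> states M \<Longrightarrow> q' \<in> states M \<Longrightarrow>
                 \<exists>r. (q, r) \<in> (state_graph M)\<^sup>* \<and> (q', r) \<in> (state_graph M)\<^sup>*"
  shows "\<exists>!C. essential_class M C"
proof -
  define V E where "V = states M" and "E = state_graph M"
  have V: "finite V" "V \<noteq> {}" using M by (auto simp: dfa_def V_def)
  have EV: "E \<subseteq> V \<times> V" using M by (auto simp: dfa_def V_def E_def state_graph_def)
  define C where "C = {r \<in> V. \<forall>q\<in>V. (q, r) \<in> E\<^sup>*}"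
  have "\<exists>r\<in>V. \<forall>q\<in>V. (q, r) \<in> E\<^sup>*"
    by (rule common_successor_of_finite_set[OF V order_refl EV]) (use conf in \<open>auto simp: V_def E_def\<close>)
  then have C_ne: "C \<noteq> {}" by (auto simp: C_def)
  have C_step: "r' \<in> C" if "r \<in> C" "(r, r') \<in> E" for r r'
    using that EV by (auto simp: C_def intro: rtrancl_into_rtrancl)
  have C_closed: "r' \<in> C" if "r \<in> C" "(r, r') \<in> E\<^sup>*" for r r'
    using that(2,1) by (induction rule: rtrancl_induct) (auto intro: C_step)
  have inside: "(r, r') \<in> (E \<inter> C \<times> C)\<^sup>*" if "(r, r') \<in> E\<^sup>*" "r \<in> C" for r r'
    using that
  proof (induction rule: rtrancl_induct)
    case (step y z)
    then have "y \<in> C" using C_closed by blast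
    then have "(y, z) \<in> E \<inter> C \<times> C" using step.hyps(2) C_step by blast
    then show ?case using step by (meson rtrancl_into_rtrancl)
  qed simp
  have loop: "loop_class M C"
    unfolding loop_class_def
  proof (intro conjI ballI)
    fix q q' assume q: "q \<in> C" and q': "q' \<in> C"
    \<comment> \<open>A loop class needs paths of positive length, so one edge is taken first and a
      path to \<open>q'\<close> follows.\<close>
    obtain r where r: "(q, r) \<in> E" using succ q by (auto simp: C_def V_def E_def)
    have "r \<in> C" using q r by (rule C_step)
    moreover have "(r, q') \<in> E\<^sup>*" using q' \<open>r \<in> C\<close> by (auto simp: C_def)
    ultimately have "(r, q') \<in> (E \<inter> C \<times> C)\<^sup>*" by (intro inside)
    then show "(q, q') \<in> (state_graph M \<inter> C \<times> C)\<^sup>+"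
      using q r \<open>r \<in> C\<close> by (auto simp: E_def intro: rtrancl_into_trancl2)
  qed (use C_ne in \<open>auto simp: C_def V_def\<close>)
  have path: "(q, q') \<in> E\<^sup>*" if "loop_class M L" "q \<in> L" "q' \<in> L" for L q q'
  proof -
    have "(q, q') \<in> (E \<inter> L \<times> L)\<^sup>+" using that by (auto simp: loop_class_def E_def)
    then have "(q, q') \<in> E\<^sup>+" by (rule trancl_mono) auto
    then show ?thesis by (rule trancl_into_rtrancl)
  qed
  have ess: "essential_class M C"
    unfolding essential_class_def
  proof (intro conjI allI impI ballI)
    fix L assume L: "loop_class M L \<and> C \<subseteq> L"
    \<comment> \<open>Every state of \<open>L\<close> is reachable from a state of \<open>C\<close>,
      and \<open>C\<close> is closed.\<close>
    then show "L = C" using path C_closed C_ne by blast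
  qed (use loop C_closed in \<open>auto simp: E_def\<close>)
  moreover have "L = C" if L: "essential_class M L" for L
  proof -
    have LL: "loop_class M L" using L by (simp add: essential_class_def)
    then obtain q where q: "q \<in> L" "q \<in> V" by (auto simp: loop_class_def V_def)
    have "C \<subseteq> L"
    proof
      fix r assume "r \<in> C"
      then have "(q, r) \<in> E\<^sup>*" using q(2) by (auto simp: C_def)
      then show "r \<in> L" using L q(1) by (auto simp: essential_class_def E_def)
    qed
    then show ?thesis using ess LL by (auto simp: essential_class_def)
  qed
  ultimately show ?thesis by blast
qed


section \<open>Affine self-maps and residual sets\<close>

text \<open>The sign \<open>s\<close> is a field element and \<open>k\<close> a natural number, so
  composition multiplies signs and adds exponents.\<close>

definition aff :: "'p::prime_card padic \<Rightarrow> nat \<Rightarrow> 'p padic \<Rightarrow> 'p padic \<Rightarrow> 'p padic" where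
  "aff s k e x = s * of_nat CARD('p) ^ k * x + e"

lemma aff_aff: "aff s k e (aff s' k' e' x) = aff (s * s') (k + k') (aff s k e e') x"
  by (simp add: aff_def algebra_simps power_add)

lemma sign_cases: "s \<in> {1, -1} \<Longrightarrow> s * s = (1 :: 'a::ring_1)"
  by auto

lemma sign_integer: "s \<in> {1, -1} \<Longrightarrow> s \<in> padic_integers"
  using padic_integers_of_int[of 1] padic_integers_of_int[of "-1"] by auto

lemma aff_integer:
  "s \<in> {1, -1} \<Longrightarrow> e \<in> padic_integers \<Longrightarrow> x \<in> padic_integers \<Longrightarrow> aff s k e x \<in> padic_integers"
  unfolding aff_def using sign_integer[of s] by (intro padic_integers_intros)

text \<open>
  The bound on \<open>\<bar>\<epsilon>\<bar>\<close> is chosen to be stable under composition; it keeps \<open>e / p ^ k\<close> bounded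
  at the archimedean place, which is what makes the family of residual sets finite.
\<close>

definition selfmap :: "'p::prime_card padic set \<Rightarrow> int \<Rightarrow> int \<Rightarrow> 'p padic \<Rightarrow> nat \<Rightarrow> 'p padic \<Rightarrow> bool"
  where "selfmap K D C s k e \<longleftrightarrow> s \<in> {1, -1} \<and> e \<in> padic_integers \<and>
    (\<exists>\<epsilon>. of_int D * e = of_int \<epsilon> \<and> \<bar>\<epsilon>\<bar> \<le> C * (int CARD('p) ^ k - 1)) \<and>
    (\<forall>x\<in>K. aff s k e x \<in> K)"

text \<open>The sign is kept general because the maximal pullback of \<open>stable_selfmap\<close>
  may belong to a map with sign -1; residual sets have sign 1.\<close>

definition pullback :: "'p::prime_card padic set \<Rightarrow> 'p padic \<Rightarrow> nat \<Rightarrow> 'p padic \<Rightarrow> 'p padic set" where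
  "pullback K s N e = {x \<in> padic_integers. aff s N e x \<in> K}"

text \<open>For \<open>w < p ^ N\<close>: the tails that may follow the \<open>N\<close> digits of
  \<open>w\<close>, lowest digit first, in an expansion of a point of \<open>K\<close>.\<close>

abbreviation residual :: "'p::prime_card padic set \<Rightarrow> nat \<Rightarrow> nat \<Rightarrow> 'p padic set" where
  "residual K N w \<equiv> pullback K 1 N (of_nat w)"

lemma selfmap_id: "selfmap K D C 1 0 0"
  using padic_integers_of_int[of 0] by (auto simp: selfmap_def aff_def)

text \<open>The bounds telescope: \<open>p ^ k * C * (p ^ k' - 1) + C * (p ^ k - 1) = C * (p ^ (k +
  k') - 1)\<close>.\<close>

lemma selfmap_comp:
  fixes K :: "'p::prime_card padic set"
  assumes f: "selfmap K D C s k e" and g: "selfmap K D C s' k' e'"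
  shows "selfmap K D C (s * s') (k + k') (aff s k e e')"
proof -
  let ?q = "int CARD('p)"
  obtain \<epsilon> where \<epsilon>: "of_int D * e = of_int \<epsilon>" "\<bar>\<epsilon>\<bar> \<le> C * (?q ^ k - 1)"
    using f by (auto simp: selfmap_def)
  obtain \<epsilon>' where \<epsilon>': "of_int D * e' = of_int \<epsilon>'" "\<bar>\<epsilon>'\<bar> \<le> C * (?q ^ k' - 1)"
    using g by (auto simp: selfmap_def)
  have s: "s \<in> {1, -1}" "s' \<in> {1, -1}" using f g by (auto simp: selfmap_def)
  \<comment> \<open>The sign as an integer, so that the numerator of the new shift can be computed
    in \<open>int\<close>.\<close>
  define \<sigma> :: int where "\<sigma> = (if s = 1 then 1 else -1)"
  have \<sigma>: "s = of_int \<sigma>" "\<bar>\<sigma>\<bar> = 1" using s by (auto simp: \<sigma>_def)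
  have "of_int D * aff s k e e' = s * of_nat CARD('p) ^ k * (of_int D * e') + of_int D * e"
    by (simp add: aff_def algebra_simps)
  also have "\<dots> = of_int (\<sigma> * ?q ^ k * \<epsilon>' + \<epsilon>)"
    by (simp add: \<epsilon> \<epsilon>' \<sigma>(1))
  finally have eq: "of_int D * aff s k e e' = of_int (\<sigma> * ?q ^ k * \<epsilon>' + \<epsilon>)" .
  have "\<bar>\<sigma> * ?q ^ k * \<epsilon>' + \<epsilon>\<bar> \<le> ?q ^ k * \<bar>\<epsilon>'\<bar> + \<bar>\<epsilon>\<bar>"
    using abs_triangle_ineq[of "\<sigma> * ?q ^ k * \<epsilon>'" \<epsilon>] by (simp add: abs_mult \<sigma>(2))
  also have "\<dots> \<le> ?q ^ k * (C * (?q ^ k' - 1)) + C * (?q ^ k - 1)"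
    by (intro add_mono mult_left_mono \<epsilon> \<epsilon>') auto
  also have "\<dots> = C * (?q ^ (k + k') - 1)"
    by (simp add: algebra_simps power_add)
  finally have bound: "\<bar>\<sigma> * ?q ^ k * \<epsilon>' + \<epsilon>\<bar> \<le> C * (?q ^ (k + k') - 1)" .
  show ?thesis
    unfolding selfmap_def
  proof (intro conjI)
    show "\<forall>x\<in>K. aff (s * s') (k + k') (aff s k e e') x \<in> K"
      using f g by (auto simp: selfmap_def aff_aff[symmetric])
    show "aff s k e e' \<in> padic_integers"
      using f g by (auto simp: selfmap_def intro: aff_integer)
    show "\<exists>\<epsilon>. of_int D * aff s k e e' = of_int \<epsilon> \<and> \<bar>\<epsilon>\<bar> \<le> C * (int CARD('p) ^ (k + k') - 1)"
      using eq bound by blast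
  qed (use s in auto)
qed

lemma selfmap_image: "selfmap K D C s k e \<Longrightarrow> x \<in> K \<Longrightarrow> aff s k e x \<in> K"
  by (simp add: selfmap_def)

lemma selfmap_sign: "selfmap K D C s k e \<Longrightarrow> s \<in> {1, -1}"
  by (simp add: selfmap_def)

lemma selfmap_shift_integer: "selfmap K D C s k e \<Longrightarrow> e \<in> padic_integers"
  by (simp add: selfmap_def)

lemma selfmap_shift_denominator: "selfmap K D C s k e \<Longrightarrow> of_int D * e \<in> \<int>"
  by (auto simp: selfmap_def)

lemma residual_residual:
  "residual K (N + m) (w + CARD('p) ^ N * u) =
     {y \<in> padic_integers. of_nat u + of_nat CARD('p) ^ m * y \<in> residual K N w}"
  for K :: "'p::prime_card padic set"
proof -
  have "of_nat u + of_nat CARD('p) ^ m * y \<in> padic_integers" if "y \<in> padic_integers" for y :: "'p padic"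
    using that by (intro padic_integers_intros)
  then show ?thesis
    by (auto simp: pullback_def aff_def algebra_simps power_add)
qed

section \<open>Finiteness of the family of residual sets\<close>

text \<open>What is kept of the given maps: \<open>K\<close> is covered by images of self-maps with
  exponent between 1 and \<open>L\<close>. As \<open>selfmap\<close> is closed under composition, no
  words in the given maps have to be tracked.\<close>

locale padic_self_covering =
  fixes K :: "'p::prime_card padic set" and D C :: int and L :: nat
  assumes K_integers: "K \<subseteq> padic_integers" and K_nonempty: "K \<noteq> {}"
    and D_pos: "D > 0" and D_coprime: "coprime D (int CARD('p))" and C_nonneg: "C \<ge> 0"
    and cover: "x \<in> K \<Longrightarrow>
      \<exists>s k e. \<exists>y\<in>K. selfmap K D C s k e \<and> 1 \<le> k \<and> k \<le> L \<and> x = aff s k e y"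
begin

text \<open>Compose covering maps one at a time. Each adds at least 1 and at most \<open>L\<close>
  to the exponent, so level \<open>N\<close> is overshot by at most \<open>L\<close>; this bound
  makes the pieces below finite in number.\<close>

lemma cover_depth:
  assumes "x \<in> K"
  shows "\<exists>s k e. \<exists>y\<in>K. selfmap K D C s k e \<and> N \<le> k \<and> k \<le> N + L \<and> x = aff s k e y"
proof (induction N)
  case 0
  have "x = aff 1 0 0 x" by (simp add: aff_def)
  then show ?case using selfmap_id assms by blast
next
  case (Suc N)
  then obtain s k e y where f: "y \<in> K" "selfmap K D C s k e" "N \<le> k" "k \<le> N + L" "x = aff s k e y"
    by blast
  show ?case
  proof (cases "k = N")
    case True
    obtain s' k' e' z where g: "z \<in> K" "selfmap K D C s' k' e'" "1 \<le> k'" "k' \<le> L" "y = aff s' k' e' z"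
      using cover[OF f(1)] by blast
    have "x = aff (s * s') (k + k') (aff s k e e') z" using f g by (simp add: aff_aff)
    moreover have "Suc N \<le> k + k'" "k + k' \<le> Suc N + L" using True g by auto
    ultimately show ?thesis using selfmap_comp[OF f(2) g(2)] g(1) by blast
  next
    case False
    then have "Suc N \<le> k" "k \<le> Suc N + L" using f by auto
    then show ?thesis using f by blast
  qed
qed

text \<open>Modulo \<open>p ^ N\<close>, a covering map with exponent at least \<open>N\<close> is
  constant on \<open>K\<close>, so its rational shift \<open>e\<close> supplies the digits.\<close>

lemma K_approximation:
  assumes "x \<in> K"
  obtains w y where "w < CARD('p) ^ N" "y \<in> padic_integers" "x = of_nat w + of_nat CARD('p) ^ N * y"
proof -
  obtain s k e z where f: "z \<in> K" "selfmap K D C s k e" "N \<le> k" "x = aff s k e z"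
    using cover_depth[OF assms, of N] by blast
  obtain w y where w: "w < CARD('p) ^ N" "y \<in> padic_integers" "e = of_nat w + of_nat CARD('p) ^ N * y"
    using nat_approximation[OF D_coprime selfmap_shift_denominator[OF f(2)]] .
  obtain j where k: "k = N + j" using f(3) by (auto simp: le_iff_add)
  have "y + s * of_nat CARD('p) ^ j * z \<in> padic_integers"
    using f(1) K_integers w(2) sign_integer[OF selfmap_sign[OF f(2)]]
    by (intro padic_integers_intros) auto
  moreover have "x = of_nat w + of_nat CARD('p) ^ N * (y + s * of_nat CARD('p) ^ j * z)"
    using f(4) w(3) by (simp add: aff_def k algebra_simps power_add)
  ultimately show thesis using that w(1) by blast
qed

text \<open>Sign, excess exponent and shift of the copies of \<open>K\<close> that can occur in a
  pullback. The set depends on the bound \<open>B\<close> for the shift relative to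
  \<open>p ^ N\<close>, but not on the depth \<open>N\<close>.\<close>

definition pieces :: "int \<Rightarrow> ('p padic \<times> nat \<times> 'p padic) set" where
  "pieces B = {1, -1} \<times> {..L} \<times> (\<lambda>\<tau>. of_int \<tau> / of_int D) ` {- (C * int CARD('p) ^ L + B) .. C * int CARD('p) ^ L + B}"

lemma finite_pieces: "finite (pieces B)"
  by (simp add: pieces_def)

text \<open>The point \<open>aff s N e y\<close> of \<open>K\<close> is covered by a self-map of
  exponent \<open>N + j\<close>. Undoing \<open>aff s N e\<close> after this map gives the piece,
  which lies in the pullback because a self-map sends \<open>K\<close> into \<open>K\<close>. The
  numerator of its shift is bounded by dividing the bounds for both shifts by
  \<open>p ^ N\<close>.\<close>

lemma pullback_piece:
  assumes s: "s \<in> {1, -1}" and e: "e \<in> padic_integers"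
    and \<epsilon>: "of_int D * e = of_int \<epsilon>" "\<bar>\<epsilon>\<bar> \<le> B * int CARD('p) ^ N"
    and y: "y \<in> pullback K s N e"
  shows "\<exists>(\<sigma>, j, t) \<in> pieces B. y \<in> aff \<sigma> j t ` K \<and> aff \<sigma> j t ` K \<subseteq> pullback K s N e"
proof -
  let ?q = "int CARD('p)" and ?P = "of_nat CARD('p) :: 'p padic"
  have ss: "s * s = 1" using s by (rule sign_cases)
  have q: "?q > 0" using prime_card[where 'a = 'p] by (simp add: prime_gt_0_nat)
  have yZ: "y \<in> padic_integers" and "aff s N e y \<in> K" using y by (auto simp: pullback_def)
  then obtain s' k e' z where f: "z \<in> K" "selfmap K D C s' k e'" "N \<le> k" "k \<le> N + L"
      "aff s N e y = aff s' k e' z"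
    using cover_depth[of "aff s N e y" N] by blast
  obtain j where k: "k = N + j" using f(3) by (auto simp: le_iff_add)
  have j: "j \<le> L" using f(4) k by simp
  obtain \<epsilon>' where \<epsilon>': "of_int D * e' = of_int \<epsilon>'" "\<bar>\<epsilon>'\<bar> \<le> C * (?q ^ k - 1)"
    using f(2) by (auto simp: selfmap_def)
  have s': "s' \<in> {1, -1}" using f(2) by (rule selfmap_sign)
  \<comment> \<open>Defining \<open>t\<close> from the points \<open>y\<close> and \<open>z\<close>
    makes it p-adically integral at once; below it turns out to be the preimage of \<open>e'\<close>
    under \<open>aff s N e\<close>.\<close>
  define \<sigma> t where "\<sigma> = s * s'" and "t = y - \<sigma> * ?P ^ j * z"
  have \<sigma>: "\<sigma> \<in> {1, -1}" using s s' by (auto simp: \<sigma>_def)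
  have yt: "y = aff \<sigma> j t z" by (simp add: aff_def t_def)
  have tZ: "t \<in> padic_integers"
    unfolding t_def using yZ f(1) K_integers sign_integer[OF \<sigma>]
    by (intro padic_integers_intros) auto
  have "?P ^ N * t = s * (s * ?P ^ N * y) - s * (s' * ?P ^ k * z)"
    unfolding t_def \<sigma>_def k using ss by (simp add: algebra_simps power_add)
  also have "\<dots> = s * (e' - e)"
  proof -
    have h: "s * ?P ^ N * y = s' * ?P ^ k * z + e' - e" using f(5) by (simp add: aff_def algebra_simps)
    show ?thesis by (subst h) (simp add: algebra_simps)
  qed
  finally have Pt: "?P ^ N * t = s * (e' - e)" .
  have "s * ?P ^ N * t = (s * s) * (e' - e)" using Pt by (simp only: mult.assoc)
  then have Pt': "aff s N e t = e'" by (simp add: aff_def ss)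
  define \<rho> :: int where "\<rho> = (if s = 1 then 1 else -1)"
  have \<rho>: "s = of_int \<rho>" "\<bar>\<rho>\<bar> = 1" using s by (auto simp: \<rho>_def)
  have "?P ^ N * (of_int D * t) = s * (of_int D * e' - of_int D * e)"
  proof -
    have "?P ^ N * (of_int D * t) = of_int D * (?P ^ N * t)" by (rule mult.left_commute)
    then show ?thesis unfolding Pt by (simp add: algebra_simps)
  qed
  also have "\<dots> = of_int (\<rho> * (\<epsilon>' - \<epsilon>))" by (simp add: \<rho>(1) \<epsilon>(1) \<epsilon>'(1))
  finally have Dt: "?P ^ N * (of_int D * t) = of_int (\<rho> * (\<epsilon>' - \<epsilon>))" .
  \<comment> \<open>Integrality at \<open>p\<close> removes the possible denominator
    \<open>p ^ N\<close> of \<open>of_int D * t\<close>.\<close>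
  have "of_int D * t \<in> padic_integers" using tZ by (intro padic_integers_intros)
  then have "of_int D * t \<in> \<int>" using padic_eq_of_int[of N "of_int D * t"] Dt by (metis Ints_of_int)
  then obtain \<tau> where \<tau>: "of_int D * t = of_int \<tau>" by (rule Ints_cases)
  have "(of_int (?q ^ N * \<tau>) :: 'p padic) = of_int (\<rho> * (\<epsilon>' - \<epsilon>))"
    using Dt by (simp add: \<tau>)
  then have eq: "?q ^ N * \<tau> = \<rho> * (\<epsilon>' - \<epsilon>)" by (simp only: of_int_eq_iff)
  \<comment> \<open>The archimedean estimate: \<open>p ^ N\<close> cancels and only the excess
    \<open>j \<le> L\<close> remains.\<close>
  have "?q ^ N * \<bar>\<tau>\<bar> = \<bar>\<epsilon>' - \<epsilon>\<bar>"
    using arg_cong[OF eq, of abs] by (simp add: abs_mult \<rho>(2))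
  also have "\<dots> \<le> \<bar>\<epsilon>'\<bar> + \<bar>\<epsilon>\<bar>" by simp
  also have "\<dots> \<le> C * ?q ^ k + B * ?q ^ N"
    using \<epsilon>(2) \<epsilon>'(2) C_nonneg by (simp add: algebra_simps)
  also have "\<dots> = ?q ^ N * (C * ?q ^ j + B)" by (simp add: k power_add algebra_simps)
  also have "\<dots> \<le> ?q ^ N * (C * ?q ^ L + B)"
    using C_nonneg j q by (intro mult_left_mono add_mono power_increasing) auto
  finally have "\<bar>\<tau>\<bar> \<le> C * ?q ^ L + B" using q by simp
  moreover have "t = of_int \<tau> / of_int D" using \<tau> D_pos by (simp add: field_simps)
  ultimately have "(\<sigma>, j, t) \<in> pieces B" using j \<sigma> by (auto simp: pieces_def abs_le_iff)
  moreover have "aff \<sigma> j t x \<in> pullback K s N e" if "x \<in> K" for x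
  proof -
    have "aff s N e (aff \<sigma> j t x) = aff s' k e' x"
      unfolding aff_aff Pt' using ss by (simp add: \<sigma>_def k mult.assoc[symmetric])
    then show ?thesis
      using that f(2) K_integers \<sigma> tZ by (auto simp: pullback_def selfmap_def aff_integer)
  qed
  ultimately show ?thesis using yt f(1) by blast
qed

text \<open>A pullback is the union of the pieces contained in it, so it is determined by a subset
  of the finite set \<open>pieces B\<close>.\<close>

lemma finite_pullbacks:
  "finite {pullback K s N e | s N e. s \<in> {1, -1} \<and> e \<in> padic_integers \<and>
     (\<exists>\<epsilon>. of_int D * e = of_int \<epsilon> \<and> \<bar>\<epsilon>\<bar> \<le> B * int CARD('p) ^ N)}" (is "finite ?F")
proof (rule finite_subset)
  show "?F \<subseteq> (\<lambda>T. \<Union>(\<sigma>, j, t)\<in>T. aff \<sigma> j t ` K) ` Pow (pieces B)"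
  proof
    fix S assume "S \<in> ?F"
    then obtain s N e \<epsilon> where S: "S = pullback K s N e" and se: "s \<in> {1, -1}" "e \<in> padic_integers"
        "of_int D * e = of_int \<epsilon>" "\<bar>\<epsilon>\<bar> \<le> B * int CARD('p) ^ N" by auto
    define T where "T = {(\<sigma>, j, t) \<in> pieces B. aff \<sigma> j t ` K \<subseteq> S}"
    have "S \<subseteq> (\<Union>(\<sigma>, j, t)\<in>T. aff \<sigma> j t ` K)"
      using pullback_piece[OF se] unfolding T_def S by fast
    moreover have "(\<Union>(\<sigma>, j, t)\<in>T. aff \<sigma> j t ` K) \<subseteq> S"
      unfolding T_def by fast
    ultimately show "S \<in> (\<lambda>T. \<Union>(\<sigma>, j, t)\<in>T. aff \<sigma> j t ` K) ` Pow (pieces B)"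
      by (intro image_eqI[of _ _ T]) (auto simp: T_def)
  qed
qed (simp add: finite_pieces)

text \<open>The shift \<open>w\<close> has numerator \<open>D * w\<close>, so \<open>B = D\<close>
  serves.\<close>

lemma finite_residuals: "finite {residual K N w | N w. w < CARD('p) ^ N}"
proof (rule finite_subset[OF _ finite_pullbacks[of D]], clarify)
  fix N w assume "w < CARD('p) ^ N"
  then have "D * int w \<le> D * int CARD('p) ^ N"
    using D_pos by (intro mult_left_mono) (auto simp flip: of_nat_power)
  then have "\<bar>D * int w\<bar> \<le> D * int CARD('p) ^ N" using D_pos by simp
  moreover have "(of_int D * of_nat w :: 'p padic) = of_int (D * int w)" by simp
  ultimately show "\<exists>s M e. residual K N w = pullback K s M e \<and> s \<in> {1, -1} \<and> e \<in> padic_integers \<and>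
      (\<exists>\<epsilon>. of_int D * e = of_int \<epsilon> \<and> \<bar>\<epsilon>\<bar> \<le> D * int CARD('p) ^ M)"
    using padic_integers_of_nat by blast
qed


text \<open>An approximation of the point \<open>w + p ^ N * x\<close> of \<open>K\<close> to
  \<open>N + m\<close> digits starts with the digits of \<open>w\<close>; what follows them
  approximates \<open>x\<close>.\<close>

lemma residual_approximation:
  assumes x: "x \<in> residual K N w" and w: "w < CARD('p) ^ N"
  obtains u y where "u < CARD('p) ^ m" "y \<in> padic_integers" "x = of_nat u + of_nat CARD('p) ^ m * y"
proof -
  let ?P = "of_nat CARD('p) :: 'p padic"
  have xZ: "x \<in> padic_integers" and "aff 1 N (of_nat w) x \<in> K" using x by (auto simp: pullback_def)
  then obtain v y where v: "v < CARD('p) ^ (N + m)" "y \<in> padic_integers"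
      "aff 1 N (of_nat w) x = of_nat v + ?P ^ (N + m) * y"
    using K_approximation by metis
  have eq: "of_nat v = of_nat w + ?P ^ N * (x - ?P ^ m * y)"
    using v(3) by (simp add: aff_def algebra_simps power_add)
  have "x - ?P ^ m * y \<in> padic_integers" using xZ v(2) by (intro padic_integers_intros)
  then obtain u where u: "u < CARD('p) ^ m" "x - ?P ^ m * y = of_nat u"
    using split_digits[OF eq _ w v(1)] by metis
  then have "x = of_nat u + ?P ^ m * y" by (simp add: algebra_simps)
  then show thesis using that u(1) v(2) by blast
qed

section \<open>Merging of residual sets\<close>

text \<open>Take \<open>m\<close> digits of \<open>x\<close>, with \<open>m\<close> so large that no
  natural number below \<open>c\<close> agrees with \<open>x\<close> to \<open>m\<close> digits.
  Then the digit block \<open>u\<close> of \<open>x\<close> satisfies \<open>u \<ge> c\<close>,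
  subtracting \<open>c\<close> changes only this block, and the tails behind \<open>u\<close> and
  \<open>u - c\<close> coincide.\<close>

lemma translated_residuals_merge:
  assumes w: "w < CARD('p) ^ N" "w' < CARD('p) ^ N'"
    and tr: "\<And>y. y \<in> padic_integers \<Longrightarrow> y \<in> residual K N w \<longleftrightarrow> y - of_nat c \<in> residual K N' w'"
    and x: "x \<in> residual K N w" "x \<notin> of_nat ` {..<c}"
  obtains m u u' where "u < CARD('p) ^ m" "u' < CARD('p) ^ m"
    "residual K (N + m) (w + CARD('p) ^ N * u) = residual K (N' + m) (w' + CARD('p) ^ N' * u')"
    "residual K (N + m) (w + CARD('p) ^ N * u) \<noteq> {}"
proof -
  let ?P = "of_nat CARD('p) :: 'p padic"
  have p: "real CARD('p) > 1" using prime_gt_1_nat[OF prime_card[where 'a = 'p]] by simp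
  \<comment> \<open>The 1 keeps the set non-empty when \<open>c = 0\<close>.\<close>
  define \<delta> where "\<delta> = Min (insert 1 ((\<lambda>i. padic_norm (x - of_nat i)) ` {..<c}))"
  have "padic_norm (x - of_nat i) > 0" if "i < c" for i
  proof -
    have "x - of_nat i \<noteq> 0" using x(2) that by auto
    then show ?thesis using padic_norm_eq_0_iff[of "x - of_nat i"] padic_norm_nonneg[of "x - of_nat i"]
      by linarith
  qed
  then have \<delta>0: "\<delta> > 0" by (auto simp: \<delta>_def)
  have \<delta>: "\<delta> \<le> padic_norm (x - of_nat i)" if "i < c" for i
    using that by (auto simp: \<delta>_def intro: Min_le)
  have "1 / real CARD('p) < 1" using p by simp
  then obtain m where m: "(1 / real CARD('p)) ^ m < \<delta>" using real_arch_pow_inv[OF \<delta>0] by blast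
  obtain u y where u: "u < CARD('p) ^ m" "y \<in> padic_integers" "x = of_nat u + ?P ^ m * y"
    using residual_approximation[OF x(1) w(1)] .
  have "padic_norm (x - of_nat u) \<le> 1 / real CARD('p) ^ m"
    unfolding padic_norm_le_iff using u by auto
  \<comment> \<open>\<open>u < c\<close> would put \<open>x\<close> within
    \<open>p ^ -m < \<delta>\<close> of a natural number below \<open>c\<close>.\<close>
  then have "c \<le> u" using \<delta>[of u] m by (force simp: power_one_over)
  define u' where "u' = u - c"
  have u': "u' < CARD('p) ^ m" using u(1) by (simp add: u'_def)
  have uu': "of_nat u' = (of_nat u - of_nat c :: 'p padic)" using \<open>c \<le> u\<close> by (simp add: u'_def)
  have mem: "of_nat u + ?P ^ m * z \<in> residual K N w \<longleftrightarrow> of_nat u' + ?P ^ m * z \<in> residual K N' w'"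
    if "z \<in> padic_integers" for z
  proof -
    have "of_nat u + ?P ^ m * z \<in> padic_integers" using that by (intro padic_integers_intros)
    then show ?thesis using tr[of "of_nat u + ?P ^ m * z"] by (simp add: uu' algebra_simps)
  qed
  have "residual K (N + m) (w + CARD('p) ^ N * u) = residual K (N' + m) (w' + CARD('p) ^ N' * u')"
    unfolding residual_residual using mem by blast
  moreover have "y \<in> residual K (N + m) (w + CARD('p) ^ N * u)"
    unfolding residual_residual using u x(1) by simp
  ultimately show thesis using that u(1) u' by blast
qed

section \<open>Self-maps with integral shift and maximal pullbacks\<close>

lemma selfmap_iterate:
  assumes "selfmap K D C 1 k e"
  shows "selfmap K D C 1 (k * m) (e * (\<Sum>i<m. of_nat CARD('p) ^ (k * i)))"
proof (induction m)
  case 0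
  then show ?case by (simp add: selfmap_id)
next
  case (Suc m)
  have "e * (\<Sum>i<Suc m. of_nat CARD('p) ^ (k * i)) = aff 1 (k * m) (e * (\<Sum>i<m. of_nat CARD('p) ^ (k * i))) e"
    by (simp add: aff_def algebra_simps)
  then show ?case using selfmap_comp[OF Suc.IH assms] by (simp add: add.commute)
qed

text \<open>Euler's theorem for the modulus \<open>D * (p ^ k - 1)\<close>, which is prime to
  \<open>p\<close>. The factor \<open>p ^ k - 1\<close> is included because it is later cancelled
  against a geometric sum, leaving a multiple of \<open>D\<close>.\<close>

lemma euler_multiple:
  assumes "k \<ge> 1"
  obtains m :: nat where "m > 0" "D * (int CARD('p) ^ k - 1) dvd int CARD('p) ^ (k * m) - 1"
proof -
  let ?p = "CARD('p)"
  have p: "?p > 1" using prime_card[where 'a = 'p] by (rule prime_gt_1_nat)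
  then have pk: "?p ^ k > 1" using assms by (intro one_less_power) auto
  define n where "n = nat D * (?p ^ k - 1)"
  have n: "n > 0" using pk D_pos by (simp add: n_def)
  have "coprime (int (nat D)) (int ?p)" using D_coprime D_pos by simp
  then have "coprime (nat D) ?p" by (simp only: coprime_int_iff)
  then have "coprime (?p ^ k) n"
    unfolding n_def using coprime_diff_one_right_nat[of "?p ^ k"] pk
    by (auto simp: coprime_commute coprime_mult_left_iff coprime_mult_right_iff)
  then have "[(?p ^ k) ^ totient n = 1] (mod n)" by (rule euler_theorem)
  then have "[int ((?p ^ k) ^ totient n) = int 1] (mod int n)" by (simp only: cong_int_iff)
  then have "int n dvd int ?p ^ (k * totient n) - 1"
    by (simp add: cong_iff_dvd_diff power_mult)
  moreover have "int n = D * (int ?p ^ k - 1)"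
    using D_pos pk by (simp add: n_def of_nat_diff)
  moreover have "totient n > 0" using n by simp
  ultimately show thesis using that by metis
qed

text \<open>A map of exponent above \<open>N\<close> covering \<open>w + p ^ N * x\<close> has a
  shift that begins with the digits of \<open>w\<close>. Its square has sign 1. A suitable iterate
  of the square multiplies the shift by a geometric sum that is divisible by \<open>D\<close>, which
  makes the shift an integer, and congruent to 1 modulo \<open>p ^ N\<close>, which preserves the
  first \<open>N\<close> digits.\<close>

lemma unipotent_selfmap:
  assumes x: "x \<in> residual K N w"
  obtains k e y where "selfmap K D C 1 k e" "N \<le> k" "e \<in> \<int>"
    "y \<in> padic_integers" "e = of_nat w + of_nat CARD('p) ^ N * y"
proof -
  let ?q = "int CARD('p)" and ?P = "of_nat CARD('p) :: 'p padic"
  have xZ: "x \<in> padic_integers" and "aff 1 N (of_nat w) x \<in> K" using x by (auto simp: pullback_def)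
  \<comment> \<open>Depth \<open>Suc N\<close> rather than \<open>N\<close> ensures
    \<open>k \<ge> 1\<close> also for \<open>N = 0\<close>.\<close>
  then obtain s k e z where f: "z \<in> K" "selfmap K D C s k e" "Suc N \<le> k"
      "aff 1 N (of_nat w) x = aff s k e z"
    using cover_depth[of _ "Suc N"] by blast
  have s: "s \<in> {1, -1}" using f(2) by (rule selfmap_sign)
  define e2 where "e2 = aff s k e e"
  have f2: "selfmap K D C 1 (k + k) e2"
    using selfmap_comp[OF f(2) f(2)] by (simp add: e2_def sign_cases[OF s])
  obtain m where m: "m > 0" "D * (?q ^ (k + k) - 1) dvd ?q ^ ((k + k) * m) - 1"
    using euler_multiple[of "k + k"] f(3) by auto
  define \<Sigma> where "\<Sigma> = (\<Sum>i<m. ?q ^ ((k + k) * i))"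
  have "?q ^ ((k + k) * m) - 1 = (?q ^ (k + k) - 1) * \<Sigma>"
    unfolding \<Sigma>_def power_mult by (rule power_diff_1_eq)
  moreover have "?q ^ (k + k) > 1"
    using prime_gt_1_nat[OF prime_card[where 'a = 'p]] f(3) by (intro one_less_power) auto
  ultimately have "D dvd \<Sigma>" using m(2) by (simp add: mult.commute)
  then obtain r where r: "\<Sigma> = D * r" by (rule dvdE)
  have \<Sigma>': "(\<Sum>i<m. ?P ^ ((k + k) * i)) = of_int \<Sigma>" by (simp add: \<Sigma>_def)
  define k' e' where "k' = (k + k) * m" and "e' = e2 * of_int \<Sigma>"
  have "selfmap K D C 1 k' e'"
    using selfmap_iterate[OF f2, of m] unfolding \<Sigma>' k'_def e'_def .
  moreover have "N \<le> k'"
  proof -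
    have "N \<le> (k + k) * 1" using f(3) by simp
    also have "\<dots> \<le> (k + k) * m" using m(1) by (intro mult_left_mono) auto
    finally show ?thesis by (simp add: k'_def)
  qed
  moreover have "e' \<in> \<int>"
  proof -
    have "e' = (of_int D * e2) * of_int r" by (simp add: e'_def r)
    then show ?thesis using selfmap_shift_denominator[OF f2] by (simp add: Ints_mult)
  qed
  moreover have "\<exists>y\<in>padic_integers. e' = of_nat w + ?P ^ N * y"
  proof -
    obtain j where k: "k = N + j" using f(3) by (metis Suc_leD le_iff_add)
    obtain m' where m': "m = Suc m'" using m(1) by (cases m) auto
    \<comment> \<open>All terms of the geometric sum except the first are multiples of
      \<open>p ^ (k + k)\<close>.\<close>
    define \<Sigma>2 where "\<Sigma>2 = (\<Sum>i<m'. ?q ^ ((k + k) * i))"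
    have "\<Sigma> = 1 + ?q ^ (k + k) * \<Sigma>2"
      unfolding \<Sigma>_def \<Sigma>2_def m' sum.lessThan_Suc_shift by (simp add: sum_distrib_left power_add)
    then have S: "(of_int \<Sigma> :: 'p padic) = 1 + ?P ^ N * (?P ^ (j + k) * of_int \<Sigma>2)"
      by (simp add: k power_add algebra_simps)
    define y where "y = x - s * ?P ^ j * z + s * ?P ^ j * e + e2 * (?P ^ (j + k) * of_int \<Sigma>2)"
    have "e = of_nat w + ?P ^ N * (x - s * ?P ^ j * z)"
      using f(4) by (simp add: aff_def k power_add algebra_simps)
    then have e2: "e2 = of_nat w + ?P ^ N * (x - s * ?P ^ j * z + s * ?P ^ j * e)"
      unfolding e2_def by (simp add: aff_def k power_add algebra_simps)
    have "e' = e2 + ?P ^ N * (e2 * (?P ^ (j + k) * of_int \<Sigma>2))"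
      unfolding e'_def S by (simp add: algebra_simps)
    also have "\<dots> = of_nat w + ?P ^ N * y"
      by (subst e2) (simp add: y_def algebra_simps)
    finally have "e' = of_nat w + ?P ^ N * y" .
    moreover have "y \<in> padic_integers"
      unfolding y_def using xZ sign_integer[OF s] f(1) K_integers selfmap_shift_integer[OF f(2)]
        selfmap_shift_integer[OF f2]
      by (intro padic_integers_intros) auto
    ultimately show ?thesis by blast
  qed
  ultimately show thesis using that by blast
qed

text \<open>Applying a further self-map afterwards can only enlarge the pullback, and there are
  finitely many pullbacks, so one that is maximal under inclusion stays unchanged.\<close>

lemma stable_selfmap:
  obtains s k e where "selfmap K D C s k e"
    "\<And>s' k' e'. selfmap K D C s' k' e' \<Longrightarrow>
       pullback K (s' * s) (k' + k) (aff s' k' e' e) = pullback K s k e"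
proof -
  define \<S> where "\<S> = {pullback K s k e | s k e. selfmap K D C s k e}"
  have "\<S> \<subseteq> {pullback K s N e | s N e. s \<in> {1, -1} \<and> e \<in> padic_integers \<and>
     (\<exists>\<epsilon>. of_int D * e = of_int \<epsilon> \<and> \<bar>\<epsilon>\<bar> \<le> C * int CARD('p) ^ N)}"
    unfolding \<S>_def
  proof clarify
    fix s k e assume f: "selfmap K D C s k e"
    then obtain \<epsilon> where \<epsilon>: "of_int D * e = of_int \<epsilon>" "\<bar>\<epsilon>\<bar> \<le> C * (int CARD('p) ^ k - 1)"
      by (auto simp: selfmap_def)
    have "\<bar>\<epsilon>\<bar> \<le> C * int CARD('p) ^ k" using \<epsilon>(2) C_nonneg by (simp add: algebra_simps)
    then show "\<exists>s' N e'. pullback K s k e = pullback K s' N e' \<and> s' \<in> {1, -1} \<and> e' \<in> padic_integers \<and>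
        (\<exists>\<epsilon>. of_int D * e' = of_int \<epsilon> \<and> \<bar>\<epsilon>\<bar> \<le> C * int CARD('p) ^ N)"
      using \<epsilon>(1) selfmap_sign[OF f] selfmap_shift_integer[OF f]
      by (intro exI[of _ s] exI[of _ k] exI[of _ e] exI[of _ \<epsilon>] conjI refl)
  qed
  then have "finite \<S>" using finite_pullbacks finite_subset by blast
  moreover have "\<S> \<noteq> {}" unfolding \<S>_def using selfmap_id by blast
  ultimately obtain S where S: "S \<in> \<S>" "\<And>T. T \<in> \<S> \<Longrightarrow> S \<subseteq> T \<Longrightarrow> S = T"
    using finite_has_maximal[of \<S>] by blast
  then obtain s k e where f: "selfmap K D C s k e" "S = pullback K s k e" unfolding \<S>_def by blast
  have "pullback K (s' * s) (k' + k) (aff s' k' e' e) = pullback K s k e" if g: "selfmap K D C s' k' e'" for s' k' e'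
  proof -
    have "pullback K (s' * s) (k' + k) (aff s' k' e' e) \<in> \<S>"
      unfolding \<S>_def using selfmap_comp[OF g f(1)] by blast
    moreover have "S \<subseteq> pullback K (s' * s) (k' + k) (aff s' k' e' e)"
      using selfmap_image[OF g] by (auto simp: f(2) pullback_def aff_aff[symmetric])
    ultimately show ?thesis using S(2) f(2) by blast
  qed
  then show thesis using that f(1) by blast
qed


text \<open>Follow the stable map by a self-map from \<open>unipotent_selfmap\<close> whose shift
  begins with the digits of \<open>w\<close>; the pullback does not change. Splitting the shift
  \<open>E\<close> of the composite into its digits \<open>v\<close> and a rest \<open>t\<close>
  turns this pullback, up to sign and translation, into the residual set of \<open>v\<close>, and
  \<open>v\<close> extends \<open>w\<close>. Modulo the integers, \<open>p ^ k * t\<close> depends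
  only on the stable map.\<close>

lemma residual_normal_form:
  assumes f: "selfmap K D C s k e"
    and stable: "\<And>s' k' e'. selfmap K D C s' k' e' \<Longrightarrow>
       pullback K (s' * s) (k' + k) (aff s' k' e' e) = pullback K s k e"
    and x: "x \<in> residual K N w" and w: "w < CARD('p) ^ N"
  obtains m u t where "u < CARD('p) ^ m" "t \<in> padic_integers" "of_nat CARD('p) ^ k * t - e \<in> \<int>"
    "residual K (N + m) (w + CARD('p) ^ N * u) = (\<lambda>x. s * x + t) ` pullback K s k e"
proof -
  let ?P = "of_nat CARD('p) :: 'p padic"
  obtain l \<epsilon> y where g: "selfmap K D C 1 l \<epsilon>" "N \<le> l" "\<epsilon> \<in> \<int>" "y \<in> padic_integers"
      "\<epsilon> = of_nat w + ?P ^ N * y"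
    using unipotent_selfmap[OF x] .
  have s: "s \<in> {1, -1}" using f by (rule selfmap_sign)
  have sZ: "s \<in> padic_integers" using s by (rule sign_integer)
  have eZ: "e \<in> padic_integers" using f by (rule selfmap_shift_integer)
  define E where "E = aff 1 l \<epsilon> e"
  have gf: "selfmap K D C s (l + k) E" using selfmap_comp[OF g(1) f] by (simp add: E_def)
  have S: "pullback K s (l + k) E = pullback K s k e" using stable[OF g(1)] by (simp add: E_def)
  obtain j where l: "l = N + j" using g(2) by (auto simp: le_iff_add)
  define m where "m = j + k"
  have lk: "l + k = N + m" by (simp add: l m_def)
  obtain v t where v: "v < CARD('p) ^ (N + m)" "t \<in> padic_integers" "E = of_nat v + ?P ^ (N + m) * t"
    using nat_approximation[OF D_coprime selfmap_shift_denominator[OF gf]] .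
  have vE: "of_nat v = \<epsilon> + ?P ^ l * e - ?P ^ (N + m) * t"
    using v(3) by (simp add: E_def aff_def algebra_simps)
  then have "of_nat v = of_nat w + ?P ^ N * (y + ?P ^ j * e - ?P ^ m * t)"
    by (simp add: g(5) l algebra_simps power_add)
  moreover have "y + ?P ^ j * e - ?P ^ m * t \<in> padic_integers"
    using g(4) eZ v(2) by (intro padic_integers_intros)
  ultimately obtain u where u: "u < CARD('p) ^ m" "v = w + CARD('p) ^ N * u"
    using split_digits[OF _ _ w v(1)] by metis
  \<comment> \<open>Here it matters that \<open>\<epsilon>\<close> is an integer: after cancelling
    \<open>p ^ l\<close> only \<open>e\<close> is left modulo the integers.\<close>
  have "?P ^ l * (?P ^ k * t - e) = \<epsilon> - of_nat v"
    unfolding vE lk[symmetric] by (simp add: algebra_simps power_add)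
  also have "\<dots> \<in> \<int>" using g(3) by (intro Ints_diff) auto
  finally have int: "?P ^ k * t - e \<in> \<int>"
    by (rule padic_eq_of_int) (intro padic_integers_intros v eZ)
  have aff_eq: "aff 1 (N + m) (of_nat v) (s * z + t) = aff s (N + m) E z" for z
    by (simp add: aff_def v(3) algebra_simps)
  have "residual K (N + m) v = (\<lambda>x. s * x + t) ` pullback K s (N + m) E"
  proof (intro equalityI subsetI)
    fix z assume z: "z \<in> residual K (N + m) v"
    have zs: "z = s * (s * (z - t)) + t" by (simp add: mult.assoc[symmetric] sign_cases[OF s])
    have "s * (z - t) \<in> padic_integers"
      using z v(2) sZ unfolding pullback_def by (intro padic_integers_intros) auto
    moreover have "aff s (N + m) E (s * (z - t)) \<in> K"
      unfolding aff_eq[symmetric] using z zs by (simp add: pullback_def)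
    ultimately show "z \<in> (\<lambda>x. s * x + t) ` pullback K s (N + m) E"
      using zs by (intro image_eqI[of _ _ "s * (z - t)"]) (auto simp: pullback_def)
  next
    fix z assume "z \<in> (\<lambda>x. s * x + t) ` pullback K s (N + m) E"
    then obtain z' where z': "z' \<in> padic_integers" "aff s (N + m) E z' \<in> K" "z = s * z' + t"
      by (auto simp: pullback_def)
    have "z \<in> padic_integers" unfolding z'(3) using z'(1) v(2) sZ by (intro padic_integers_intros)
    then show "z \<in> residual K (N + m) v" using z' by (simp add: pullback_def aff_eq)
  qed
  then show thesis using that[OF u(1) v(2) int] S by (simp add: u(2) lk)
qed

section \<open>Common descendants of any two residual sets\<close>

text \<open>A self-map with positive exponent sends two points of \<open>K\<close> at the smallest
  positive distance to two distinct points at a smaller one.\<close>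

lemma infinite_K:
  assumes "x \<in> K" "y \<in> K" "x \<noteq> y"
  shows "infinite K"
proof
  assume fin: "finite K"
  define A where "A = {padic_norm (u - v) | u v. u \<in> K \<and> v \<in> K \<and> u \<noteq> v}"
  have fA: "finite A"
  proof (rule finite_subset)
    show "A \<subseteq> (\<lambda>(u, v). padic_norm (u - v)) ` (K \<times> K)" by (auto simp: A_def)
  qed (simp add: fin)
  have "padic_norm (x - y) \<in> A" unfolding A_def using assms by blast
  then have ne: "A \<noteq> {}" by blast
  have pos: "a > 0" if "a \<in> A" for a
  proof -
    obtain u v :: "'p padic" where "u \<noteq> v" "a = padic_norm (u - v)" using \<open>a \<in> A\<close> unfolding A_def by blast
    then show ?thesis using padic_norm_eq_0_iff[of "u - v"] padic_norm_nonneg[of "u - v"] by auto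
  qed
  obtain u v where uv: "u \<in> K" "v \<in> K" "u \<noteq> v" "padic_norm (u - v) = Min A"
  proof -
    have "\<exists>u v. Min A = padic_norm (u - v) \<and> u \<in> K \<and> v \<in> K \<and> u \<noteq> v"
      using Min_in[OF fA ne] by (subst (asm) (2) A_def) blast
    then show thesis using that by metis
  qed
  obtain s k e z where f: "selfmap K D C s k e" "1 \<le> k" using cover[OF assms(1)] by blast
  have s: "padic_norm s = 1"
    using selfmap_sign[OF f(1)] padic_norm_power[of "1 :: 'p padic" 0] padic_norm_minus[of "1 :: 'p padic"] by auto
  have "aff s k e u - aff s k e v = s * of_nat CARD('p) ^ k * (u - v)"
    by (simp add: aff_def algebra_simps)
  then have norm: "padic_norm (aff s k e u - aff s k e v) = padic_norm (u - v) / real CARD('p) ^ k"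
    by (simp add: padic_norm_mult s padic_norm_card_power)
  have pk: "1 < real CARD('p) ^ k"
    using prime_gt_1_nat[OF prime_card[where 'a = 'p]] f(2) by (intro one_less_power) auto
  have M0: "Min A > 0" using pos Min_in[OF fA ne] by blast
  then have lt: "padic_norm (aff s k e u - aff s k e v) < Min A"
    unfolding norm uv(4) using pk by (simp add: divide_less_eq)
  moreover have "padic_norm (aff s k e u - aff s k e v) > 0"
    unfolding norm uv(4) using pk M0 by simp
  then have "aff s k e u \<noteq> aff s k e v"
    using padic_norm_eq_0_iff[of "aff s k e u - aff s k e v"] by auto
  then have "padic_norm (aff s k e u - aff s k e v) \<in> A"
    unfolding A_def using selfmap_image[OF f(1)] uv(1,2) by blast
  then have "Min A \<le> padic_norm (aff s k e u - aff s k e v)" using fA by (rule Min_le[rotated])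
  ultimately show False by simp
qed

text \<open>The confluence needed for \<open>unique_essential_class\<close>, phrased with digit
  blocks; these may differ in length.\<close>

definition mergeable :: "nat \<Rightarrow> nat \<Rightarrow> nat \<Rightarrow> nat \<Rightarrow> bool" where
  "mergeable N w N' w' \<longleftrightarrow> (\<exists>m u m' u'. u < CARD('p) ^ m \<and> u' < CARD('p) ^ m' \<and>
     residual K (N + m) (w + CARD('p) ^ N * u) = residual K (N' + m') (w' + CARD('p) ^ N' * u') \<and>
     residual K (N + m) (w + CARD('p) ^ N * u) \<noteq> {})"

lemma mergeable_sym: "mergeable N w N' w' \<Longrightarrow> mergeable N' w' N w"
  unfolding mergeable_def by metis

lemma mergeable_descendants:
  assumes "mergeable (N + m) (w + CARD('p) ^ N * u) (N' + m') (w' + CARD('p) ^ N' * u')"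
    and u: "u < CARD('p) ^ m" "u' < CARD('p) ^ m'"
  shows "mergeable N w N' w'"
proof -
  have eq: "w + CARD('p) ^ N * u + CARD('p) ^ (N + m) * a = w + CARD('p) ^ N * (u + CARD('p) ^ m * a)"
    for w N u m a by (simp add: algebra_simps power_add)
  obtain l a l' a' where a: "a < CARD('p) ^ l" "a' < CARD('p) ^ l'"
    and R: "residual K (N + (m + l)) (w + CARD('p) ^ N * (u + CARD('p) ^ m * a)) =
      residual K (N' + (m' + l')) (w' + CARD('p) ^ N' * (u' + CARD('p) ^ m' * a'))"
      "residual K (N + (m + l)) (w + CARD('p) ^ N * (u + CARD('p) ^ m * a)) \<noteq> {}"
    using assms(1) unfolding mergeable_def eq add.assoc[of N] add.assoc[of N'] by blast
  show ?thesis
    unfolding mergeable_def using R join_digits[OF u(1) a(1)] join_digits[OF u(2) a(2)] by blast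
qed

text \<open>Both \<open>w\<close> and \<open>w'\<close> consist of the lowest digits of
  \<open>r\<close>, so the longer block extends the shorter. Residual sets are finite here, so the
  translation argument, which has to avoid finitely many integers, does not apply.\<close>

lemma mergeable_singleton:
  assumes K: "K = {r}" and N: "N \<le> N'" and w: "w < CARD('p) ^ N" "w' < CARD('p) ^ N'"
    and ne: "residual K N w \<noteq> {}" "residual K N' w' \<noteq> {}"
  shows "mergeable N w N' w'"
proof -
  let ?P = "of_nat CARD('p) :: 'p padic"
  obtain m where m: "N' = N + m" using N by (auto simp: le_iff_add)
  obtain x where x: "x \<in> padic_integers" "?P ^ N * x + of_nat w = r"
    using ne(1) by (auto simp: pullback_def aff_def K)
  obtain x' where x': "x' \<in> padic_integers" "?P ^ N' * x' + of_nat w' = r"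
    using ne(2) by (auto simp: pullback_def aff_def K)
  have "of_nat w' = of_nat w + ?P ^ N * (x - ?P ^ m * x')"
    using x(2) x'(2) by (simp add: m algebra_simps power_add)
  moreover have "x - ?P ^ m * x' \<in> padic_integers" using x(1) x'(1) by (intro padic_integers_intros)
  ultimately obtain u where "u < CARD('p) ^ m" "w' = w + CARD('p) ^ N * u"
    using split_digits[OF _ _ w(1)] w(2) m by metis
  then show ?thesis
    unfolding mergeable_def using ne(2)
    by (intro exI[of _ m] exI[of _ u] exI[of _ 0]) (simp add: m)
qed

text \<open>If \<open>K\<close> has at least two points it is infinite, and so is the maximal
  pullback. Both residual sets have descendants that are images of this same pullback with the same
  sign, and their shifts differ by an integer \<open>c\<close>. An infinite set has a point outside
  the finitely many integers to be avoided, so \<open>translated_residuals_merge\<close>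
  applies.\<close>

lemma residuals_mergeable:
  assumes w: "w < CARD('p) ^ N" "w' < CARD('p) ^ N'"
    and ne: "residual K N w \<noteq> {}" "residual K N' w' \<noteq> {}"
  shows "mergeable N w N' w'"
proof (cases "\<exists>r. K = {r}")
  case True
  then obtain r where r: "K = {r}" by blast
  show ?thesis
    using mergeable_singleton[OF r _ w ne] mergeable_singleton[OF r _ w(2,1) ne(2,1)] mergeable_sym
    by (meson nle_le)
next
  case False
  let ?P = "of_nat CARD('p) :: 'p padic"
  obtain x y where "x \<in> K" "y \<in> K" "x \<noteq> y" using False K_nonempty by blast
  then have inf: "infinite K" by (rule infinite_K)
  obtain s k e where f: "selfmap K D C s k e"
    and stable: "\<And>s' k' e'. selfmap K D C s' k' e' \<Longrightarrow>
       pullback K (s' * s) (k' + k) (aff s' k' e' e) = pullback K s k e"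
    using stable_selfmap by blast
  have s: "s * s = 1" using selfmap_sign[OF f] by (rule sign_cases)
  have "K \<subseteq> pullback K s k e" using K_integers selfmap_image[OF f] by (auto simp: pullback_def)
  then have infS: "infinite (pullback K s k e)" using inf finite_subset by blast
  have inj: "inj (\<lambda>x. s * x + t)" for t
  proof (rule injI)
    fix x y assume "s * x + t = s * y + t"
    then have "s * s * x = s * s * y" by (simp add: mult.assoc)
    then show "x = y" by (simp add: s)
  qed
  obtain z z' where z: "z \<in> residual K N w" "z' \<in> residual K N' w'" using ne by blast
  obtain m u t where A: "u < CARD('p) ^ m" "t \<in> padic_integers" "?P ^ k * t - e \<in> \<int>"
    "residual K (N + m) (w + CARD('p) ^ N * u) = (\<lambda>x. s * x + t) ` pullback K s k e"
    using residual_normal_form[OF f stable z(1) w(1)] .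
  obtain m' u' t' where B: "u' < CARD('p) ^ m'" "t' \<in> padic_integers" "?P ^ k * t' - e \<in> \<int>"
    "residual K (N' + m') (w' + CARD('p) ^ N' * u') = (\<lambda>x. s * x + t') ` pullback K s k e"
    using residual_normal_form[OF f stable z(2) w(2)] .
  have "?P ^ k * (t - t') = (?P ^ k * t - e) - (?P ^ k * t' - e)" by (simp add: algebra_simps)
  also have "\<dots> \<in> \<int>" using A(3) B(3) by (rule Ints_diff)
  finally have "t - t' \<in> \<int>" by (rule padic_eq_of_int) (intro padic_integers_diff A B)
  then obtain c where c: "t - t' = of_int c" by (rule Ints_cases)
  \<comment> \<open>Stated for arbitrary data with \<open>c \<ge> 0\<close>, so that for negative
    \<open>c\<close> the two residual sets can be exchanged.\<close>
  have merge: "mergeable M v M' v'"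
    if v: "v < CARD('p) ^ M" "v' < CARD('p) ^ M'" and c: "t - t' = of_int c" "c \<ge> 0"
      and R: "residual K M v = (\<lambda>x. s * x + t) ` pullback K s k e"
        "residual K M' v' = (\<lambda>x. s * x + t') ` pullback K s k e"
    for M v M' v' c t t'
  proof -
    have tt: "t = t' + of_nat (nat c)" using c by (simp add: algebra_simps)
    have "infinite (residual K M v)" unfolding R(1) using infS inj finite_imageD inj_on_subset by blast
    then have "\<not> residual K M v \<subseteq> of_nat ` {..<nat c}" using finite_surj by blast
    then obtain x where x: "x \<in> residual K M v" "x \<notin> of_nat ` {..<nat c}" by blast
    have "y \<in> residual K M v \<longleftrightarrow> y - of_nat (nat c) \<in> residual K M' v'" for y
      unfolding R tt by (auto simp: image_iff algebra_simps)
    then show ?thesis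
      using translated_residuals_merge[OF v _ x] unfolding mergeable_def by metis
  qed
  show ?thesis
  proof (cases "c \<ge> 0")
    case True
    show ?thesis
      by (rule mergeable_descendants[OF merge[OF join_digits[OF w(1) A(1)] join_digits[OF w(2) B(1)] c True A(4) B(4)] A(1) B(1)])
  next
    case False
    have "t' - t = of_int (- c)" using c by (simp add: algebra_simps)
    then have "mergeable (N' + m') (w' + CARD('p) ^ N' * u') (N + m) (w + CARD('p) ^ N * u)"
      by (rule merge[OF join_digits[OF w(2) B(1)] join_digits[OF w(1) A(1)] _ _ B(4) A(4)])
        (use False in simp)
    then show ?thesis by (rule mergeable_sym[OF mergeable_descendants[OF _ B(1) A(1)]])
  qed
qed


section \<open>The residual automaton\<close>

definition residuals :: "'p padic set set" where
  "residuals = {residual K N w | N w. w < CARD('p) ^ N} - {{}}"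

definition shift :: "nat \<Rightarrow> 'p padic set \<Rightarrow> 'p padic set" where
  "shift a S = {y \<in> padic_integers. of_nat a + of_nat CARD('p) * y \<in> S}"

text \<open>The renaming \<open>f\<close> serves to obtain states of type \<open>nat\<close> in the
  end. A transition to the empty set is left undefined: as all states accept, it must not be
  possible to continue a run there.\<close>

definition residual_automaton :: "('p padic set \<Rightarrow> 's) \<Rightarrow> 's automaton" where
  "residual_automaton f = \<lparr>states = f ` residuals, initial = f (residual K 0 0),
     trans = (\<lambda>q a. let T = shift a (the_inv_into residuals f q) in
       if q \<in> f ` residuals \<and> a < CARD('p) \<and> T \<noteq> {} then Some (f T) else None)\<rparr>"

lemma shift_residual: "shift a (residual K N w) = residual K (Suc N) (w + CARD('p) ^ N * a)"
  using residual_residual[of K N 1 w a] by (simp add: shift_def)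

lemma residualsE:
  assumes "S \<in> residuals"
  obtains N w x where "w < CARD('p) ^ N" "S = residual K N w" "x \<in> residual K N w"
  using assms by (auto simp: residuals_def)

lemma residuals_I: "w < CARD('p) ^ N \<Longrightarrow> residual K N w \<noteq> {} \<Longrightarrow> residual K N w \<in> residuals"
  by (auto simp: residuals_def)

lemma shift_residuals:
  assumes "S \<in> residuals" "a < CARD('p)" "shift a S \<noteq> {}"
  shows "shift a S \<in> residuals"
proof -
  obtain N w x where S: "w < CARD('p) ^ N" "S = residual K N w" using assms(1) by (rule residualsE)
  have "shift a S = residual K (Suc N) (w + CARD('p) ^ N * a)" by (simp only: S(2) shift_residual)
  moreover have "w + CARD('p) ^ N * a < CARD('p) ^ Suc N"
    using join_digits[OF S(1), of a 1] assms(2) by simp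
  ultimately show ?thesis using residuals_I assms(3) by metis
qed

lemma initial_residual: "residual K 0 0 \<in> residuals"
  using K_nonempty K_integers by (intro residuals_I) (auto simp: pullback_def aff_def)

context
  fixes f :: "'p padic set \<Rightarrow> 's"
  assumes inj: "inj_on f residuals"
begin

lemma trans_residual_automaton:
  assumes "S \<in> residuals"
  shows "trans (residual_automaton f) (f S) a =
    (if a < CARD('p) \<and> shift a S \<noteq> {} then Some (f (shift a S)) else None)"
  using assms by (simp add: residual_automaton_def the_inv_into_f_f[OF inj] Let_def)

lemma states_residual_automaton: "states (residual_automaton f) = f ` residuals"
  and initial_residual_automaton: "initial (residual_automaton f) = f (residual K 0 0)"
  by (simp_all add: residual_automaton_def)

lemma dfa_residual_automaton: "dfa CARD('p) (residual_automaton f)"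
proof -
  have "finite residuals" using finite_residuals by (simp add: residuals_def)
  then show ?thesis
    using initial_residual shift_residuals
    by (auto simp: dfa_def states_residual_automaton initial_residual_automaton
        trans_residual_automaton split: if_splits)
qed

lemma state_graph_step:
  assumes "S \<in> residuals" "a < CARD('p)" "shift a S \<noteq> {}"
  shows "(f S, f (shift a S)) \<in> state_graph (residual_automaton f)"
  using assms trans_residual_automaton[OF assms(1), of a]
  by (auto simp: state_graph_def states_residual_automaton)

text \<open>Induction on the length, reading the last digit separately. A non-empty set at the end
  forces all earlier ones to be non-empty, so every intermediate set is a state.\<close>

lemma state_graph_path:
  assumes w: "w < CARD('p) ^ N" and u: "u < CARD('p) ^ m"
    and ne: "residual K (N + m) (w + CARD('p) ^ N * u) \<noteq> {}"
  shows "(f (residual K N w), f (residual K (N + m) (w + CARD('p) ^ N * u)))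
           \<in> (state_graph (residual_automaton f))\<^sup>*"
  using u ne
proof (induction m arbitrary: u)
  case (Suc m)
  let ?p = "CARD('p)"
  \<comment> \<open>Lowest digits are read first, so the last digit read is the top one,
    \<open>a\<close>.\<close>
  define v a where "v = u mod ?p ^ m" and "a = u div ?p ^ m"
  have pm: "?p ^ m > 0" using prime_gt_0_nat[OF prime_card[where 'a = 'p]] by simp
  have u: "u = v + ?p ^ m * a" by (simp add: v_def a_def)
  have v: "v < ?p ^ m" using pm by (simp add: v_def)
  have a: "a < ?p" using Suc.prems(1) pm by (simp add: a_def less_mult_imp_div_less)
  let ?S = "residual K (N + m) (w + ?p ^ N * v)"
  have "w + ?p ^ N * u = w + ?p ^ N * v + ?p ^ (N + m) * a"
    by (simp add: u algebra_simps power_add)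
  then have S: "residual K (N + Suc m) (w + ?p ^ N * u) = shift a ?S"
    by (simp only: shift_residual add_Suc_right)
  have ne': "shift a ?S \<noteq> {}" using Suc.prems(2) S by simp
  then have neS: "?S \<noteq> {}" by (auto simp: shift_def)
  have "(f (residual K N w), f ?S) \<in> (state_graph (residual_automaton f))\<^sup>*"
    by (rule Suc.IH[OF v neS])
  moreover have "(f ?S, f (shift a ?S)) \<in> state_graph (residual_automaton f)"
    using residuals_I[OF join_digits[OF w v] neS] a ne' by (rule state_graph_step)
  ultimately show ?case unfolding S by (rule rtrancl_into_rtrancl)
qed simp

lemma unique_essential_class_residual_automaton: "\<exists>!C. essential_class (residual_automaton f) C"
proof (rule unique_essential_class[OF dfa_residual_automaton])
  fix q assume "q \<in> states (residual_automaton f)"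
  then obtain S where S: "q = f S" "S \<in> residuals" by (auto simp: states_residual_automaton)
  obtain N w x where w: "w < CARD('p) ^ N" "S = residual K N w" "x \<in> residual K N w"
    using S(2) by (rule residualsE)
  obtain a y where "a < CARD('p) ^ 1" "y \<in> padic_integers" "x = of_nat a + of_nat CARD('p) ^ 1 * y"
    using residual_approximation[OF w(3) w(1)] .
  then have "a < CARD('p)" "y \<in> shift a S" using w by (auto simp: shift_def)
  then show "\<exists>q'. (q, q') \<in> state_graph (residual_automaton f)"
    using state_graph_step[OF S(2)] S(1) by blast
next
  fix q q' assume "q \<in> states (residual_automaton f)" "q' \<in> states (residual_automaton f)"
  then obtain S S' where S: "q = f S" "S \<in> residuals" "q' = f S'" "S' \<in> residuals"
    by (auto simp: states_residual_automaton)
  obtain N w x where w: "w < CARD('p) ^ N" "S = residual K N w" "x \<in> residual K N w"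
    using S(2) by (rule residualsE)
  obtain N' w' x' where w': "w' < CARD('p) ^ N'" "S' = residual K N' w'" "x' \<in> residual K N' w'"
    using S(4) by (rule residualsE)
  have "mergeable N w N' w'" using w w' by (intro residuals_mergeable) auto
  then obtain m u m' u' where u: "u < CARD('p) ^ m" "u' < CARD('p) ^ m'"
    and R: "residual K (N + m) (w + CARD('p) ^ N * u) = residual K (N' + m') (w' + CARD('p) ^ N' * u')"
      "residual K (N + m) (w + CARD('p) ^ N * u) \<noteq> {}"
    unfolding mergeable_def by blast
  have ne': "residual K (N' + m') (w' + CARD('p) ^ N' * u') \<noteq> {}" using R by simp
  show "\<exists>r. (q, r) \<in> (state_graph (residual_automaton f))\<^sup>* \<and>
            (q', r) \<in> (state_graph (residual_automaton f))\<^sup>*"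
    using state_graph_path[OF w(1) u(1) R(2)] state_graph_path[OF w'(1) u(2) ne'] S w w' R(1)
    by metis
qed

end

section \<open>Digit sums and the recognized language\<close>

definition digit_sum :: "(nat \<Rightarrow> nat) \<Rightarrow> nat \<Rightarrow> nat" where
  "digit_sum c N = (\<Sum>i<N. c i * CARD('p) ^ i)"

lemma digit_sum_simps [simp]: "digit_sum c 0 = 0"
  "digit_sum c (Suc N) = digit_sum c N + CARD('p) ^ N * c N"
  by (simp_all add: digit_sum_def)

lemma digit_sum_less: "(\<And>i. c i < CARD('p)) \<Longrightarrow> digit_sum c N < CARD('p) ^ N"
  using join_digits[of "digit_sum c N" "CARD('p)" N "c N" 1 for N] by (induction N) auto

lemma digit_sum_add: "\<exists>z. digit_sum c (N + m) = digit_sum c N + CARD('p) ^ N * z"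
proof (induction m)
  case (Suc m)
  then obtain z where "digit_sum c (N + m) = digit_sum c N + CARD('p) ^ N * z" by blast
  then have "digit_sum c (N + Suc m) = digit_sum c N + CARD('p) ^ N * (z + CARD('p) ^ m * c (N + m))"
    by (simp add: algebra_simps power_add)
  then show ?case by blast
qed (auto intro: exI[of _ 0])

text \<open>Runs are deterministic: after \<open>N\<close> digits the state is the residual set of
  their digit sum, and the run continues exactly as long as these sets are non-empty.\<close>

lemma recognized_residual_automaton:
  assumes inj: "inj_on f residuals"
  shows "recognized (residual_automaton f) =
    {c. (\<forall>i. c i < CARD('p)) \<and> (\<forall>N. residual K N (digit_sum c N) \<noteq> {})}"
proof (intro equalityI subsetI; clarsimp)
  fix c assume "c \<in> recognized (residual_automaton f)"
  then obtain r where r0: "r 0 = f (residual K 0 0)"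
    and r: "\<And>i. trans (residual_automaton f) (r i) (c i) = Some (r (Suc i))"
    by (auto simp: recognized_def initial_residual_automaton[OF inj])
  have step: "r N = f (residual K N (digit_sum c N)) \<and> residual K N (digit_sum c N) \<in> residuals" for N
  proof (induction N)
    case 0
    then show ?case using r0 initial_residual by simp
  next
    case (Suc N)
    then have "c N < CARD('p) \<and> shift (c N) (residual K N (digit_sum c N)) \<noteq> {} \<and>
        r (Suc N) = f (shift (c N) (residual K N (digit_sum c N)))"
      using r[of N] by (simp add: trans_residual_automaton[OF inj] split: if_splits)
    then show ?case
      using shift_residuals[of "residual K N (digit_sum c N)" "c N"] Suc
      by (simp add: shift_residual)
  qed
  show "(\<forall>i. c i < CARD('p)) \<and> (\<forall>N. residual K N (digit_sum c N) \<noteq> {})"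
  proof (intro conjI allI)
    fix i show "c i < CARD('p)"
      using r[of i] step[of i] by (simp add: trans_residual_automaton[OF inj] split: if_splits)
  next
    fix N show "residual K N (digit_sum c N) \<noteq> {}" using step[of N] by (auto simp: residuals_def)
  qed
next
  fix c assume c: "\<forall>i. c i < CARD('p)" and ne: "\<forall>N. residual K N (digit_sum c N) \<noteq> {}"
  have "residual K N (digit_sum c N) \<in> residuals" for N
    using residuals_I digit_sum_less c ne by blast
  then have "trans (residual_automaton f) (f (residual K i (digit_sum c i))) (c i) =
      Some (f (residual K (Suc i) (digit_sum c (Suc i))))" for i
    using c ne[rule_format, of "Suc i"] by (simp add: trans_residual_automaton[OF inj] shift_residual)
  then show "c \<in> recognized (residual_automaton f)"
    unfolding recognized_def initial_residual_automaton[OF inj]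
    by (intro CollectI exI[of _ "\<lambda>i. f (residual K i (digit_sum c i))"]) simp
qed

text \<open>By \<open>padic_norm_le_iff\<close> the ball of radius \<open>p ^ -N\<close> around
  \<open>w\<close> consists of the numbers \<open>w + p ^ N * y\<close> with \<open>y\<close>
  p-adically integral.\<close>

lemma residual_nonempty_iff:
  "residual K N w \<noteq> {} \<longleftrightarrow> (\<exists>x\<in>K. dist x (of_nat w) \<le> 1 / real CARD('p) ^ N)"
proof
  assume "residual K N w \<noteq> {}"
  then obtain y where "y \<in> padic_integers" "aff 1 N (of_nat w) y \<in> K" by (auto simp: pullback_def)
  moreover from this have "dist (aff 1 N (of_nat w) y) (of_nat w) \<le> 1 / real CARD('p) ^ N"
    unfolding dist_padic_def padic_norm_le_iff by (auto simp: aff_def)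
  ultimately show "\<exists>x\<in>K. dist x (of_nat w) \<le> 1 / real CARD('p) ^ N" by blast
next
  assume "\<exists>x\<in>K. dist x (of_nat w) \<le> 1 / real CARD('p) ^ N"
  then obtain x y where "x \<in> K" "y \<in> padic_integers" "x - of_nat w = of_nat CARD('p) ^ N * y"
    unfolding dist_padic_def padic_norm_le_iff by blast
  then have "y \<in> residual K N w" by (auto simp: pullback_def aff_def diff_eq_eq)
  then show "residual K N w \<noteq> {}" by blast
qed

lemma dist_digit_sum:
  assumes "N \<le> M"
  shows "dist (of_nat (digit_sum c M) :: 'p padic) (of_nat (digit_sum c N)) \<le> 1 / real CARD('p) ^ N"
proof -
  obtain m where "M = N + m" using assms by (auto simp: le_iff_add)
  then obtain z where "digit_sum c M = digit_sum c N + CARD('p) ^ N * z" using digit_sum_add by blast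
  then have "of_nat (digit_sum c M) - of_nat (digit_sum c N) = of_nat CARD('p) ^ N * (of_nat z :: 'p padic)"
    by simp
  then show ?thesis unfolding dist_padic_def padic_norm_le_iff using padic_integers_of_nat by blast
qed

text \<open>A limit \<open>x\<close> in \<open>K\<close> lies within \<open>p ^ -N\<close> of the
  \<open>N\<close>-th partial sum. Conversely, points of \<open>K\<close> near the partial sums have
  a convergent subsequence by compactness, and the partial sums share its limit.\<close>

lemma padic_expansions_iff:
  assumes "compact K"
  shows "padic_expansions K =
    {c. (\<forall>i. c i < CARD('p)) \<and> (\<forall>N. residual K N (digit_sum c N) \<noteq> {})}"
proof -
  let ?r = "\<lambda>N. 1 / real CARD('p) ^ N"
  have p: "real CARD('p) > 1" using prime_gt_1_nat[OF prime_card[where 'a = 'p]] by simp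
  have r0: "?r \<longlonglongrightarrow> 0"
    using LIMSEQ_realpow_zero[of "1 / real CARD('p)"] p by (simp add: power_one_over)
  have "(\<exists>x\<in>K. (\<lambda>i. of_nat (c i) * of_nat CARD('p) ^ i) sums x) \<longleftrightarrow>
        (\<forall>N. residual K N (digit_sum c N) \<noteq> {})" for c
  proof -
    have sums: "(\<lambda>i. of_nat (c i) * of_nat CARD('p) ^ i) sums x \<longleftrightarrow>
        (\<lambda>N. of_nat (digit_sum c N)) \<longlonglongrightarrow> x" for x :: "'p padic"
      by (simp add: sums_def digit_sum_def)
    show ?thesis
      unfolding sums
    proof
      assume "\<exists>x\<in>K. (\<lambda>N. of_nat (digit_sum c N)) \<longlonglongrightarrow> x"
      then obtain x where x: "x \<in> K" "(\<lambda>N. of_nat (digit_sum c N)) \<longlonglongrightarrow> x" by blast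
      have "dist x (of_nat (digit_sum c N)) \<le> ?r N" for N
      proof (rule tendsto_upperbound)
        show "(\<lambda>M. dist (of_nat (digit_sum c M) :: 'p padic) (of_nat (digit_sum c N))) \<longlonglongrightarrow> dist x (of_nat (digit_sum c N))"
          by (rule tendsto_dist[OF x(2) tendsto_const])
        show "\<forall>\<^sub>F M in sequentially. dist (of_nat (digit_sum c M) :: 'p padic) (of_nat (digit_sum c N)) \<le> ?r N"
          by (intro eventually_sequentiallyI[of N] dist_digit_sum)
      qed simp
      then show "\<forall>N. residual K N (digit_sum c N) \<noteq> {}" using residual_nonempty_iff x(1) by blast
    next
      assume "\<forall>N. residual K N (digit_sum c N) \<noteq> {}"
      then have "\<forall>N. \<exists>x\<in>K. dist x (of_nat (digit_sum c N)) \<le> ?r N" using residual_nonempty_iff by blast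
      then obtain X where X: "\<And>N. X N \<in> K" "\<And>N. dist (X N) (of_nat (digit_sum c N)) \<le> ?r N" by metis
      obtain l \<rho> where l: "l \<in> K" "strict_mono \<rho>" "(X \<circ> \<rho>) \<longlonglongrightarrow> l"
        using compact_imp_seq_compact[OF assms] X(1) unfolding seq_compact_def by metis
      have bound: "dist (of_nat (digit_sum c N)) l \<le> ?r N + ?r N" for N
      proof -
        \<comment> \<open>Compare both through the digit sum of length \<open>\<rho> n\<close>,
          which is at least \<open>N\<close>.\<close>
        have "dist (X (\<rho> n)) (of_nat (digit_sum c N)) \<le> ?r N + ?r N" if "n \<ge> N" for n
        proof -
          have n: "N \<le> \<rho> n" using that seq_suble[OF l(2), of n] by simp
          have "dist (X (\<rho> n)) (of_nat (digit_sum c N)) \<le>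
              dist (X (\<rho> n)) (of_nat (digit_sum c (\<rho> n))) +
              dist (of_nat (digit_sum c (\<rho> n)) :: 'p padic) (of_nat (digit_sum c N))"
            by (rule dist_triangle)
          also have "\<dots> \<le> ?r (\<rho> n) + ?r N" by (intro add_mono X dist_digit_sum n)
          also have "?r (\<rho> n) \<le> ?r N"
            using p n by (intro divide_left_mono power_increasing mult_pos_pos) auto
          finally show ?thesis by simp
        qed
        then have "\<forall>\<^sub>F n in sequentially. dist ((X \<circ> \<rho>) n) (of_nat (digit_sum c N)) \<le> ?r N + ?r N"
          unfolding eventually_at_top_linorder comp_def by blast
        moreover have "(\<lambda>n. dist ((X \<circ> \<rho>) n) (of_nat (digit_sum c N))) \<longlonglongrightarrow> dist l (of_nat (digit_sum c N))"
          by (rule tendsto_dist[OF l(3) tendsto_const])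
        ultimately have "dist l (of_nat (digit_sum c N)) \<le> ?r N + ?r N"
          by (intro tendsto_upperbound) auto
        then show ?thesis by (simp add: dist_commute)
      qed
      have "(\<lambda>N. dist (of_nat (digit_sum c N)) l) \<longlonglongrightarrow> 0"
      proof (rule Lim_null_comparison)
        show "\<forall>\<^sub>F N in sequentially. norm (dist (of_nat (digit_sum c N)) l) \<le> ?r N + ?r N"
          using bound by (intro always_eventually allI) (simp only: real_norm_def abs_of_nonneg zero_le_dist)
        show "(\<lambda>N. ?r N + ?r N) \<longlonglongrightarrow> 0" using tendsto_add[OF r0 r0] by simp
      qed
      then have "(\<lambda>N. of_nat (digit_sum c N)) \<longlonglongrightarrow> l" by (rule iffD2[OF tendsto_dist_iff])
      then show "\<exists>x\<in>K. (\<lambda>N. of_nat (digit_sum c N)) \<longlonglongrightarrow> x" using l(1) by blast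
    qed
  qed
  then show ?thesis by (simp add: padic_expansions_def)
qed

lemma residual_automaton_exists:
  assumes "compact K"
  shows "\<exists>M :: nat automaton. dfa CARD('p) M \<and> recognized M = padic_expansions K \<and>
    (\<exists>!C. essential_class M C)"
proof -
  have "finite residuals" using finite_residuals by (simp add: residuals_def)
  then obtain f :: "'p padic set \<Rightarrow> nat" where f: "inj_on f residuals"
    using finite_imp_inj_to_nat_seg by metis
  have "recognized (residual_automaton f) = padic_expansions K"
    by (simp only: recognized_residual_automaton[OF f] padic_expansions_iff[OF assms])
  then show ?thesis
    using dfa_residual_automaton[OF f] unique_essential_class_residual_automaton[OF f]
    by (intro exI[of _ "residual_automaton f"] conjI)
qed

end

section \<open>From the self-similar set to the abstract covering\<close>

text \<open>Compactness gives a point \<open>x\<close> of largest norm. Writing it as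
  \<open>aff s k e y\<close>, the ultrametric inequality bounds its norm by the maximum of
  \<open>padic_norm x / p ^ k\<close> and 1, which forces it to be at most 1.\<close>

lemma self_similar_set_integers:
  fixes K :: "'p::prime_card padic set"
  assumes "compact K" and cover: "\<And>x. x \<in> K \<Longrightarrow> \<exists>s k e. \<exists>y\<in>K.
    s \<in> {1, -1} \<and> 1 \<le> k \<and> e \<in> padic_integers \<and> x = aff s k e y"
  shows "K \<subseteq> padic_integers"
proof (cases "K = {}")
  case False
  have "continuous_on K (\<lambda>x. dist x 0)" by (intro continuous_intros)
  then obtain x where x: "x \<in> K" "\<And>y. y \<in> K \<Longrightarrow> dist y 0 \<le> dist x 0"
    using continuous_attains_sup[OF assms(1) False] by blast
  obtain s k e y where f: "y \<in> K" "s \<in> {1, -1}" "1 \<le> k" "e \<in> padic_integers" "x = aff s k e y"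
    using cover[OF x(1)] by blast
  have pk: "1 < real CARD('p) ^ k"
    using prime_gt_1_nat[OF prime_card[where 'a = 'p]] f(3) by (intro one_less_power) auto
  have s: "padic_norm s = 1"
    using f(2) padic_norm_power[of "1 :: 'p padic" 0] padic_norm_minus[of "1 :: 'p padic"] by auto
  have "padic_norm x \<le> max (padic_norm (s * of_nat CARD('p) ^ k * y)) (padic_norm e)"
    unfolding f(5) aff_def by (rule padic_norm_ultrametric)
  also have "\<dots> \<le> max (padic_norm y / real CARD('p) ^ k) 1"
    using f(4) by (intro max.mono) (simp_all add: padic_norm_mult s padic_norm_card_power padic_integers_def)
  also have "\<dots> \<le> max (padic_norm x / real CARD('p) ^ k) 1"
    using x(2)[OF f(1)] pk by (intro max.mono divide_right_mono) (simp_all add: dist_padic_def)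
  finally have le: "padic_norm x \<le> max (padic_norm x / real CARD('p) ^ k) 1" .
  have "padic_norm x \<le> 1"
  proof (rule ccontr)
    assume "\<not> padic_norm x \<le> 1"
    then have "padic_norm x \<le> padic_norm x / real CARD('p) ^ k" "padic_norm x > 0" using le by auto
    then have "padic_norm x * real CARD('p) ^ k \<le> padic_norm x * 1" using pk by (simp add: pos_le_divide_eq)
    then show False using pk \<open>padic_norm x > 0\<close> by (simp only: mult_le_cancel_left_pos)
  qed
  then show ?thesis using x(2) by (force simp: padic_integers_def dist_padic_def)
qed simp

lemma common_denominator:
  fixes d :: "'i \<Rightarrow> 'p::prime_card padic"
  assumes "finite I" "\<And>i. i \<in> I \<Longrightarrow> d i \<in> padic_integers \<inter> \<rat>"
  shows "\<exists>D>0. coprime D (int CARD('p)) \<and> (\<forall>i\<in>I. of_int D * d i \<in> \<int>)"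
  using assms
proof (induction I rule: finite_induct)
  case empty
  then show ?case by (intro exI[of _ 1]) auto
next
  case (insert i I)
  then obtain D where D: "D > 0" "coprime D (int CARD('p))" "\<forall>i\<in>I. of_int D * d i \<in> \<int>" by auto
  obtain D' where D': "D' > 0" "coprime D' (int CARD('p))" "of_int D' * d i \<in> \<int>"
    using rational_padic_integer[of "d i"] insert.prems by blast
  have "of_int (D * D') * d j \<in> \<int>" if "j \<in> insert i I" for j
  proof (cases "j = i")
    case True
    have "of_int (D * D') * d i = of_int D * (of_int D' * d i)" by (simp add: mult_ac)
    then show ?thesis using D'(3) True by (metis Ints_mult Ints_of_int)
  next
    case False
    have "of_int (D * D') * d j = of_int D' * (of_int D * d j)" by (simp add: mult_ac)
    then show ?thesis using D(3) that False by (metis Ints_mult Ints_of_int insertE)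
  qed
  then show ?case using D D' by (intro exI[of _ "D * D'"]) auto
qed

lemma self_similar_map_aff:
  assumes "k \<ge> 0"
  shows "self_similar_map b k d = aff ((- 1) ^ b) (nat k) d"
  using assms by (auto simp: self_similar_map_def aff_def power_int_def)

theorem theorem5p8:
  fixes n :: nat and b :: "nat \<Rightarrow> nat" and k :: "nat \<Rightarrow> int"
    and d :: "nat \<Rightarrow> 'p::prime_card padic" and K :: "'p padic set"
  assumes "n \<ge> 1"
    and "\<And>i. i \<in> {1..n} \<Longrightarrow> b i \<in> {0, 1}"
    and "\<And>i. i \<in> {1..n} \<Longrightarrow> k i \<ge> 1"
    and "\<And>i. i \<in> {1..n} \<Longrightarrow> d i \<in> padic_integers \<inter> \<rat>"
    and "is_self_similar_set {1..n} (\<lambda>i. self_similar_map (b i) (k i) (d i)) K"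
  shows "\<exists>M :: nat automaton. dfa CARD('p) M \<and>
           recognized M = padic_expansions K \<and> (\<exists>!C. essential_class M C)"
proof -
  let ?s = "\<lambda>i. (- 1 :: 'p padic) ^ b i"
  have K: "compact K" "K \<noteq> {}" "K = (\<Union>i\<in>{1..n}. self_similar_map (b i) (k i) (d i) ` K)"
    using assms(5) unfolding is_self_similar_set_def by auto
  have k: "nat (k i) \<ge> 1" if "i \<in> {1..n}" for i using assms(3)[OF that] by simp
  have F: "self_similar_map (b i) (k i) (d i) = aff (?s i) (nat (k i)) (d i)" if "i \<in> {1..n}" for i
    using assms(3)[OF that] by (intro self_similar_map_aff) simp
  have s: "?s i \<in> {1, -1}" if "i \<in> {1..n}" for i using assms(2)[OF that] by auto
  have cov: "\<exists>i\<in>{1..n}. \<exists>y\<in>K. x = aff (?s i) (nat (k i)) (d i) y" if "x \<in> K" for x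
  proof -
    have "x \<in> (\<Union>i\<in>{1..n}. self_similar_map (b i) (k i) (d i) ` K)"
      using that by (simp only: K(3)[symmetric])
    then obtain i y where "i \<in> {1..n}" "y \<in> K" "x = self_similar_map (b i) (k i) (d i) y" by blast
    then show ?thesis using F by auto
  qed
  have maps: "aff (?s i) (nat (k i)) (d i) y \<in> K" if "i \<in> {1..n}" "y \<in> K" for i y
  proof -
    have "self_similar_map (b i) (k i) (d i) y \<in> (\<Union>i\<in>{1..n}. self_similar_map (b i) (k i) (d i) ` K)"
      using that by blast
    then show ?thesis by (simp only: K(3)[symmetric] F[OF that(1)])
  qed
  obtain D where D: "D > 0" "coprime D (int CARD('p))" "\<forall>i\<in>{1..n}. of_int D * d i \<in> \<int>"
    using common_denominator[of "{1..n}" d] assms(4) by auto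
  have "\<forall>i\<in>{1..n}. \<exists>z. of_int D * d i = of_int z" using D(3) by (auto elim: Ints_cases)
  then obtain \<epsilon> where \<epsilon>: "\<And>i. i \<in> {1..n} \<Longrightarrow> of_int D * d i = of_int (\<epsilon> i)"
    using bchoice by metis
  \<comment> \<open>Sums serve as upper bounds: \<open>C\<close> for all numerators,
    \<open>L\<close> for all exponents. Since \<open>p ^ k i - 1 \<ge> 1\<close>, the bound required
    by \<open>selfmap\<close> follows.\<close>
  define C where "C = (\<Sum>i\<in>{1..n}. \<bar>\<epsilon> i\<bar>)"
  define L where "L = (\<Sum>i\<in>{1..n}. nat (k i))"
  have C0: "C \<ge> 0" by (simp add: C_def sum_nonneg)
  have sm: "selfmap K D C (?s i) (nat (k i)) (d i)" if i: "i \<in> {1..n}" for i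
  proof -
    have "\<bar>\<epsilon> i\<bar> \<le> C * 1" using member_le_sum[of i "{1..n}" "\<lambda>i. \<bar>\<epsilon> i\<bar>"] i by (simp add: C_def)
    also have "\<dots> \<le> C * (int CARD('p) ^ nat (k i) - 1)"
    proof -
      have "1 < int CARD('p) ^ nat (k i)"
        using prime_gt_1_nat[OF prime_card[where 'a = 'p]] k[OF i] by (intro one_less_power) auto
      then show ?thesis using C0 by (intro mult_left_mono) auto
    qed
    finally show ?thesis
      unfolding selfmap_def using s[OF i] \<epsilon>[OF i] assms(4)[OF i] maps[OF i] by blast
  qed
  have L: "nat (k i) \<le> L" if "i \<in> {1..n}" for i using member_le_sum[of i "{1..n}" "\<lambda>i. nat (k i)"] that by (simp add: L_def)
  interpret padic_self_covering K D C L
  proof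
    show "K \<subseteq> padic_integers"
    proof (rule self_similar_set_integers[OF K(1)])
      fix x assume "x \<in> K"
      then obtain i y where i: "i \<in> {1..n}" "y \<in> K" "x = aff (?s i) (nat (k i)) (d i) y"
        using cov by blast
      then show "\<exists>s k e. \<exists>y\<in>K. s \<in> {1, -1} \<and> 1 \<le> k \<and> e \<in> padic_integers \<and> x = aff s k e y"
        using s[OF i(1)] k[OF i(1)] assms(4)[OF i(1)] by blast
    qed
  next
    fix x assume "x \<in> K"
    then obtain i y where i: "i \<in> {1..n}" "y \<in> K" "x = aff (?s i) (nat (k i)) (d i) y"
      using cov by blast
    then show "\<exists>s k e. \<exists>y\<in>K. selfmap K D C s k e \<and> 1 \<le> k \<and> k \<le> L \<and> x = aff s k e y"
      using sm[OF i(1)] k[OF i(1)] L[OF i(1)] by blast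
  qed (use K(2) D C0 in auto)
  show ?thesis by (rule residual_automaton_exists[OF K(1)])
qed

end
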